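(* Let $m\ge2$, $n\ge1$ and let $\boldsymbol\alpha$ be a badly approximable real $m\times n$ matrix. Then the set $\mathcal T\!\mathbf{ad}(\boldsymbol\alpha)$ of badly $\boldsymbol\alpha$-approximable vectors is absolute winning on $\mathbb R^m$, and consequently for every $C^1$ submanifold $\mathcal M\subset\mathbb R^m$ one has $\dim_H(\mathcal M\cap\mathcal T\!\mathbf{ad}(\boldsymbol\alpha))=\dim\mathcal M$.
   Context: $\|\cdot\|$ is the Euclidean norm. $\boldsymbol\alpha$ is badly approximable if there is $c>0$ with $\|\boldsymbol\alpha\mathbf q+\mathbf p\|> c\|\mathbf q\|^{-n/m}$ for all $(\mathbf p,\mathbf q)\in\mathbb Z^m\times(\mathbb Z^n\setminus\{\mathbf 0\})$ (equivalently, only finitely many solutions of the reverse inequality for some $c>0$). $\boldsymbol\beta\in\mathbb R^m$ is badly $\boldsymbol\alpha$-approximable if there is $c>0$ such that only finitely many $(\mathbf p,\mathbf q)\in\mathbb Z^m\times(\mathbb Z^n\setminus\{\mathbf 0\})$ satisfy $\|\boldsymbol\alpha\mathbf q+\boldsymbol\beta+\mathbf p\|\le c\|\mathbf q\|^{-n/m}$; $\mathcal T\!\mathbf{ad}(\boldsymbol\alpha)$ is the set of such $\boldsymbol\beta$. Absolute game (McMullen): for $0<\beta<1$ and closed $\Lambda\subset\mathbb R^d$, players Bob and Alice alternately choose closed balls $B_1,A_1,B_2,A_2,\dots$ with centers in $\Lambda$, Bob first, such that $B_{k+1}\subset B_k\setminus A_k$, $\rho(A_k)\le\beta\rho(B_k)$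 and $\rho(B_{k+1})\ge\beta\rho(B_k)$, where $\rho$ is the radius; the outcome is the point of $\bigcap_k B_k$. A set $S$ is absolute $\beta$-winning on $\Lambda$ if Alice has a strategy guaranteeing the outcome lies in $S$ whatever Bob does, and absolute winning if it is absolute $\beta$-winning for every $0<\beta<1$. $\dim_H$ is Hausdorff dimension. *)

theory Defs
  imports "HOL-Analysis.Analysis"
begin

definition int_vectors :: "(real ^ 'k) set" where
  "int_vectors = {x. \<forall>i. x $ i \<in> \<int>}"

definition badly_approximable :: "real ^ 'n ^ 'm \<Rightarrow> bool" where
  "badly_approximable \<alpha> \<longleftrightarrow>
     (\<exists>c>0. \<forall>p\<in>int_vectors. \<forall>q\<in>int_vectors - {0}.
        norm (\<alpha> *v q + p) > c * norm q powr (- (real CARD('n) / real CARD('m))))"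

definition Tad :: "real ^ 'n ^ 'm \<Rightarrow> (real ^ 'm) set" where
  "Tad \<alpha> = {\<beta>. \<exists>c>0. finite {(p, q). p \<in> int_vectors \<and> q \<in> int_vectors - {0} \<and>
     norm (\<alpha> *v q + \<beta> + p) \<le> c * norm q powr (- (real CARD('n) / real CARD('m)))}}"

text \<open>McMullen's absolute game. A move is a pair \<open>(x, r)\<close> standing for the closed ball of centre \<open>x\<close> and radius \<open>r > 0\<close>.\<close>

definition game_ball :: "'a::euclidean_space \<times> real \<Rightarrow> 'a set" where
  "game_ball B = cball (fst B) (snd B)"

definition game_balls_on :: "'a::euclidean_space set \<Rightarrow> ('a \<times> real) set" where
  "game_balls_on \<Lambda> = {B. fst B \<in> \<Lambda> \<and> 0 < snd B}"

text \<open>A strategy for Alice maps the nonempty list \<open>[B\<^sub>1, \<dots>, B\<^sub>k]\<close> of Bob's moves so far to her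
  reply \<open>A\<^sub>k\<close>; her own earlier moves are determined by it. It must prescribe a legal reply to
  every such list.\<close>

definition alice_strategy ::
  "real \<Rightarrow> 'a::euclidean_space set \<Rightarrow> (('a \<times> real) list \<Rightarrow> 'a \<times> real) \<Rightarrow> bool" where
  "alice_strategy \<beta> \<Lambda> \<sigma> \<longleftrightarrow>
     (\<forall>h. h \<noteq> [] \<and> set h \<subseteq> game_balls_on \<Lambda> \<longrightarrow>
        \<sigma> h \<in> game_balls_on \<Lambda> \<and> snd (\<sigma> h) \<le> \<beta> * snd (last h))"

text \<open>\<open>B k\<close> is Bob's \<open>(k+1)\<close>-st ball in an infinite legal play in which Alice follows \<open>\<sigma>\<close>.\<close>

definition bob_play_against ::
  "real \<Rightarrow> 'a::euclidean_space set \<Rightarrow> (('a \<times> real) list \<Rightarrow> 'a \<times> real) \<Rightarrow> (nat \<Rightarrow> 'a \<times> real) \<Rightarrow> bool"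
where
  "bob_play_against \<beta> \<Lambda> \<sigma> B \<longleftrightarrow>
     (\<forall>k. B k \<in> game_balls_on \<Lambda>) \<and>
     (\<forall>k. game_ball (B (Suc k)) \<subseteq> game_ball (B k) - game_ball (\<sigma> (map B [0..<Suc k])) \<and>
          snd (B (Suc k)) \<ge> \<beta> * snd (B k))"

text \<open>Only infinite plays have an outcome, so Bob does not win by running out of legal moves
  (which can happen only for large \<open>\<beta>\<close> when \<open>\<Lambda>\<close> is the whole space). If the radii do not tend
  to 0, the intersection need not be a single point; as in McMullen's paper, Alice then wins
  iff the intersection meets \<open>S\<close>.\<close>

definition absolute_beta_winning ::
  "real \<Rightarrow> 'a::euclidean_space set \<Rightarrow> 'a set \<Rightarrow> bool" where
  "absolute_beta_winning \<beta> \<Lambda> S \<longleftrightarrow>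
     (\<exists>\<sigma>. alice_strategy \<beta> \<Lambda> \<sigma> \<and>
        (\<forall>B. bob_play_against \<beta> \<Lambda> \<sigma> B \<longrightarrow> (\<Inter>k. game_ball (B k)) \<inter> S \<noteq> {}))"

definition absolute_winning :: "'a::euclidean_space set \<Rightarrow> 'a set \<Rightarrow> bool" where
  "absolute_winning \<Lambda> S \<longleftrightarrow> (\<forall>\<beta>. 0 < \<beta> \<and> \<beta> < 1 \<longrightarrow> absolute_beta_winning \<beta> \<Lambda> S)"

text \<open>The convention is \<open>(diam U)\<^sup>0 = 1\<close> for nonempty \<open>U\<close>, whereas \<open>0 powr 0 = 0\<close>.
  Boundedness of the covering sets is required because \<^const>\<open>diameter\<close> is meaningless for
  unbounded sets; finite covers are included since the sets \<open>U i\<close> may be empty.\<close>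

definition diameter_pow :: "real \<Rightarrow> 'a::metric_space set \<Rightarrow> ennreal" where
  "diameter_pow s U =
     (if U = {} then 0 else if s = 0 then 1 else ennreal (diameter U powr s))"

definition hausdorff_premeasure :: "real \<Rightarrow> real \<Rightarrow> 'a::metric_space set \<Rightarrow> ennreal" where
  "hausdorff_premeasure s \<delta> X =
     Inf {(\<Sum>i. diameter_pow s (U i)) | U :: nat \<Rightarrow> 'a set.
       X \<subseteq> (\<Union>i. U i) \<and> (\<forall>i. bounded (U i) \<and> diameter (U i) \<le> \<delta>)}"

definition hausdorff_measure :: "real \<Rightarrow> 'a::metric_space set \<Rightarrow> ennreal" where
  "hausdorff_measure s X = (SUP \<delta>\<in>{0<..}. hausdorff_premeasure s \<delta> X)"

definition hausdorff_dim :: "'a::metric_space set \<Rightarrow> ereal" where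
  "hausdorff_dim X = Inf (ereal ` {s. 0 \<le> s \<and> hausdorff_measure s X = 0})"

text \<open>Intended for open \<open>U\<close>.\<close>

definition C1_on :: "('a::euclidean_space \<Rightarrow> 'b::euclidean_space) \<Rightarrow> 'a set \<Rightarrow> bool" where
  "C1_on f U \<longleftrightarrow>
     (\<exists>f' :: 'a \<Rightarrow> ('a \<Rightarrow>\<^sub>L 'b).
        (\<forall>x\<in>U. (f has_derivative blinfun_apply (f' x)) (at x)) \<and> continuous_on U f')"

text \<open>Submanifolds of pure dimension \<open>d\<close>, without boundary, given by slice charts
  \<open>\<phi> : U \<rightarrow> V\<close> with inverse \<open>\<psi>\<close>. The empty set qualifies for every \<open>d\<close>.\<close>

definition C1_submanifold :: "nat \<Rightarrow> 'a::euclidean_space set \<Rightarrow> bool" where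
  "C1_submanifold d M \<longleftrightarrow>
     (\<forall>x\<in>M. \<exists>(U :: 'a set) (V :: 'a set) \<phi> \<psi> L.
        open U \<and> x \<in> U \<and> open V \<and> homeomorphism U V \<phi> \<psi> \<and> C1_on \<phi> U \<and> C1_on \<psi> V \<and>
        subspace L \<and> dim L = d \<and> \<phi> ` (U \<inter> M) = V \<inter> L)"

end

theory Submission
  imports Defs
begin

text \<open>
  The points \<open>- (\<alpha> q + p)\<close> with \<open>norm q \<le> T\<close> are separated by a constant times \<open>T powr (- n / m)\<close>,
  because \<open>\<alpha>\<close> is badly approximable. At most one of them is therefore close to a ball of
  Bob whose radius is of this order, and Alice removes a neighbourhood of it.

  For the dimension of \<open>M \<inter> S\<close> with \<open>S\<close> absolute winning, suppose that a piece of \<open>M \<inter> S\<close>, in a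
  bi-Lipschitz chart, is covered by sets whose diameters have a small sum of \<open>s\<close>-th powers, where
  \<open>s < d\<close>. Bob plays balls centred on \<open>M\<close>, choosing the next one among about \<open>N\<^sup>d\<close> well separated
  candidates that are smaller by a factor \<open>N\<close>. Alice destroys only one candidate and each
  covering set meets only one, so by averaging some candidate meets sets of so little weight that
  Bob can go on forever. The outcome lies in \<open>M \<inter> S\<close> and in none of the covering sets.
\<close>

section \<open>The absolute game\<close>

text \<open>A smaller parameter binds Alice more tightly and leaves Bob more freedom, so a strategy
  that wins for \<open>b\<close> is legal and still wins for \<open>\<beta>\<close>.\<close>

lemma absolute_beta_winning_mono:
  assumes "absolute_beta_winning b \<Lambda> S" "b \<le> \<beta>" "S \<subseteq> T"
  shows "absolute_beta_winning \<beta> \<Lambda> T"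
proof -
  obtain \<sigma> where \<sigma>: "alice_strategy b \<Lambda> \<sigma>"
    and win: "\<And>B. bob_play_against b \<Lambda> \<sigma> B \<Longrightarrow> (\<Inter>k. game_ball (B k)) \<inter> S \<noteq> {}"
    using assms(1) unfolding absolute_beta_winning_def by blast
  have le: "b * snd X \<le> \<beta> * snd X" if "X \<in> game_balls_on \<Lambda>" for X :: "'a \<times> real"
    using that assms(2) by (intro mult_right_mono) (auto simp: game_balls_on_def)
  have "alice_strategy \<beta> \<Lambda> \<sigma>"
    unfolding alice_strategy_def
  proof (intro allI impI)
    fix h :: "('a \<times> real) list"
    assume h: "h \<noteq> [] \<and> set h \<subseteq> game_balls_on \<Lambda>"
    then have "last h \<in> game_balls_on \<Lambda>" by auto
    from le[OF this] h \<sigma> show "\<sigma> h \<in> game_balls_on \<Lambda> \<and> snd (\<sigma> h) \<le> \<beta> * snd (last h)"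
      unfolding alice_strategy_def by force
  qed
  moreover have "(\<Inter>k. game_ball (B k)) \<inter> T \<noteq> {}" if B: "bob_play_against \<beta> \<Lambda> \<sigma> B" for B
  proof -
    have "bob_play_against b \<Lambda> \<sigma> B"
      using B le unfolding bob_play_against_def by (meson order_trans)
    with win assms(3) show ?thesis by blast
  qed
  ultimately show ?thesis unfolding absolute_beta_winning_def by blast
qed

lemma absolute_winning_mono:
  "absolute_winning \<Lambda> S \<Longrightarrow> S \<subseteq> T \<Longrightarrow> absolute_winning \<Lambda> T"
  unfolding absolute_winning_def using absolute_beta_winning_mono by blast

section \<open>Nested balls and the construction of plays\<close>

lemma bob_play_ball_antimono:
  assumes "bob_play_against \<beta> \<Lambda> \<sigma> B" "i \<le> j"
  shows "game_ball (B j) \<subseteq> game_ball (B i)"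
  using assms(2)
proof (induction j rule: dec_induct)
  case (step n)
  then show ?case using assms(1) unfolding bob_play_against_def by blast
qed simp

lemma bob_play_radius_pos: "bob_play_against \<beta> \<Lambda> \<sigma> B \<Longrightarrow> 0 < snd (B k)"
  unfolding bob_play_against_def game_balls_on_def by blast

lemma bob_play_dist_centre:
  assumes "bob_play_against \<beta> \<Lambda> \<sigma> B" "i \<le> j"
  shows "dist (fst (B j)) (fst (B i)) + snd (B j) \<le> snd (B i)"
  using bob_play_ball_antimono[OF assms] bob_play_radius_pos[OF assms(1), of j]
  by (auto simp: game_ball_def cball_subset_cball_iff)

lemma bob_play_Inter_nonempty:
  assumes "bob_play_against \<beta> \<Lambda> \<sigma> B"
  shows "\<exists>w. \<forall>k. w \<in> game_ball (B k)"
proof -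
  have "(\<Inter>k. game_ball (B k)) \<noteq> {}"
  proof (intro compact_nest)
    show "game_ball (B k) \<noteq> {}" for k
      using bob_play_radius_pos[OF assms, of k] by (simp add: game_ball_def)
  qed (use bob_play_ball_antimono[OF assms] in \<open>auto simp: game_ball_def\<close>)
  then show ?thesis by blast
qed

text \<open>Dependent choice for Bob: \<open>P\<close> is an invariant that he can restore after
  every legal reply of Alice. His radii shrink by exactly the factor \<open>\<beta>\<close>, so for
  0 < \<beta> < 1 they tend to 0.\<close>

lemma bob_play_exists:
  fixes \<sigma> :: "('a::euclidean_space \<times> real) list \<Rightarrow> 'a \<times> real"
  assumes \<sigma>: "alice_strategy \<beta> \<Lambda> \<sigma>"
    and init: "P B0"
    and legal: "\<And>B. P B \<Longrightarrow> B \<in> game_balls_on \<Lambda>"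
    and step: "\<And>B A. P B \<Longrightarrow> A \<in> game_balls_on \<Lambda> \<Longrightarrow> snd A \<le> \<beta> * snd B \<Longrightarrow>
      \<exists>B'. P B' \<and> game_ball B' \<subseteq> game_ball B - game_ball A \<and> snd B' = \<beta> * snd B"
  obtains B where "B 0 = B0" "\<And>k. P (B k)" "bob_play_against \<beta> \<Lambda> \<sigma> B"
    "\<And>k. snd (B k) = \<beta> ^ k * snd B0"
proof -
  define ok where "ok B A B' \<longleftrightarrow>
      P B' \<and> game_ball B' \<subseteq> game_ball B - game_ball A \<and> snd B' = \<beta> * snd B" for B A B'
  \<comment> \<open>Since \<open>\<sigma>\<close> reads the whole history, the recursion builds the
    lists of moves, and the balls are recovered as their last entries.\<close>
  define H where "H = rec_nat [B0] (\<lambda>_ h. h @ [SOME B'. ok (last h) (\<sigma> h) B'])"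
  define B where "B k = last (H k)" for k
  have H0: "H 0 = [B0]"
    and HS: "H (Suc k) = H k @ [SOME B'. ok (last (H k)) (\<sigma> (H k)) B']" for k
    by (simp_all add: H_def)
  have H: "H k = map B [0..<Suc k]" for k
    by (induction k) (simp_all add: H0 HS B_def)
  \<comment> \<open>Alice's reply is known to be legal only if every ball of the history is, so the
    induction carries \<open>P\<close> for all earlier balls as well.\<close>
  have P: "(\<forall>i\<le>k. P (B i)) \<and> (\<forall>i<k. ok (B i) (\<sigma> (H i)) (B (Suc i)))" for k
  proof (induction k)
    case 0
    then show ?case by (simp add: B_def H0 init)
  next
    case (Suc k)
    have "set (H k) \<subseteq> game_balls_on \<Lambda>"
    proof -
      have "B i \<in> game_balls_on \<Lambda>" if "i \<le> k" for i using Suc legal that by blast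
      then show ?thesis unfolding H by (auto simp del: split_paired_All)
    qed
    moreover have "H k \<noteq> []" by (simp add: H)
    ultimately have "\<sigma> (H k) \<in> game_balls_on \<Lambda>" "snd (\<sigma> (H k)) \<le> \<beta> * snd (B k)"
      using \<sigma> unfolding alice_strategy_def B_def by blast+
    then have "\<exists>B'. ok (B k) (\<sigma> (H k)) B'"
      unfolding ok_def using Suc by (intro step) auto
    then have "ok (B k) (\<sigma> (H k)) (B (Suc k))"
      unfolding B_def[of "Suc k"] HS by (simp add: B_def someI_ex)
    with Suc show ?case by (auto simp: le_Suc_eq less_Suc_eq ok_def)
  qed
  have PB: "P (B k)" for k using P[of k] by blast
  have ok: "ok (B k) (\<sigma> (map B [0..<Suc k])) (B (Suc k))" for k
    using P[of "Suc k"] unfolding H by blast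
  have B0: "B 0 = B0" by (simp add: B_def H0)
  show thesis
  proof (rule that)
    show "B 0 = B0" by (rule B0)
    show "P (B k)" for k by (rule PB)
    show "bob_play_against \<beta> \<Lambda> \<sigma> B"
      using ok legal PB unfolding bob_play_against_def ok_def by auto
    show "snd (B k) = \<beta> ^ k * snd B0" for k
      using ok by (induction k) (auto simp: B0 ok_def)
  qed
qed

section \<open>A winning criterion for sets separated at every scale\<close>

lemma bob_can_avoid:
  fixes x a :: "'a::euclidean_space"
  assumes "0 < \<beta>" "\<beta> \<le> 1/4" "0 < \<rho>" "r \<le> \<beta> * \<rho>"
  shows "\<exists>y. cball y (\<beta> * \<rho>) \<subseteq> cball x \<rho> - cball a r"
proof -
  obtain e :: 'a where e: "norm e = 1" by (meson SOME_Basis norm_Basis)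
  \<comment> \<open>The candidates s = 1 and s = -1 lie at the two ends of a diameter, as far out as
    containment permits. Their centres are \<open>2 * (1 - \<beta>) * \<rho>\<close> apart, which
    exceeds \<open>4 * (\<beta> * \<rho>)\<close> since \<beta> \<le> 1/4, so \<open>a\<close> is
    within \<open>2 * (\<beta> * \<rho>)\<close> of at most one of them.\<close>
  define y where "y s = x + (s * (1 - \<beta>) * \<rho>) *\<^sub>R e" for s
  have sub: "cball (y s) (\<beta> * \<rho>) \<subseteq> cball x \<rho>" if "\<bar>s\<bar> = 1" for s
  proof -
    have "dist (y s) x = \<bar>s\<bar> * \<bar>1 - \<beta>\<bar> * \<bar>\<rho>\<bar>" by (simp add: y_def dist_norm abs_mult e)
    also have "\<dots> = \<rho> - \<beta> * \<rho>" using that assms by (simp add: algebra_simps)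
    finally show ?thesis unfolding cball_subset_cball_iff by simp
  qed
  have "y 1 - y (-1) = (2 * (1 - \<beta>) * \<rho>) *\<^sub>R e" by (simp add: y_def algebra_simps flip: scaleR_add_left)
  then have "dist (y 1) (y (-1)) = 2 * (1 - \<beta>) * \<rho>" using assms by (simp add: dist_norm e)
  also have "\<dots> > 4 * (\<beta> * \<rho>)"
  proof -
    have "\<beta> * \<rho> \<le> 1/4 * \<rho>" using assms by (intro mult_right_mono) auto
    then show ?thesis using assms by (simp add: algebra_simps)
  qed
  finally have "dist (y 1) a > 2 * (\<beta> * \<rho>) \<or> dist (y (-1)) a > 2 * (\<beta> * \<rho>)"
    using dist_triangle2[of "y 1" "y (-1)" a] by linarith
  then obtain s where s: "\<bar>s\<bar> = 1" "dist (y s) a > 2 * (\<beta> * \<rho>)" by (metis abs_minus abs_one)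
  have "cball (y s) (\<beta> * \<rho>) \<inter> cball a r = {}"
  proof -
    have False if "dist (y s) z \<le> \<beta> * \<rho>" "dist a z \<le> r" for z
      using that dist_triangle2[of "y s" a z] s(2) assms(4) by linarith
    then show ?thesis by auto
  qed
  then show ?thesis using sub[OF s(1)] by blast
qed

text \<open>\<open>Z \<rho>\<close> holds the dangerous points at scale \<rho>. By separation at
  most one of them lies within \<open>2 * \<rho>\<close> of the centre of a ball of radius \<rho>.
  Alice covers that one, and all others are more than \<rho> away from every point of the ball. The
  constants \<gamma> and \<open>\<rho>1\<close> may vary with \<open>w\<close>, so that one and the
  same set serves every parameter of the game.\<close>

lemma absolute_winning_separated:
  fixes Z :: "real \<Rightarrow> 'a::euclidean_space set"
  assumes anti: "\<And>\<rho> \<rho>'. 0 < \<rho> \<Longrightarrow> \<rho> \<le> \<rho>' \<Longrightarrow> Z \<rho>' \<subseteq> Z \<rho>"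
    and "0 < \<rho>0"
    and sep: "\<And>\<rho> z z'. 0 < \<rho> \<Longrightarrow> \<rho> < \<rho>0 \<Longrightarrow> z \<in> Z \<rho> \<Longrightarrow> z' \<in> Z \<rho> \<Longrightarrow>
      dist z z' \<le> 4 * \<rho> \<Longrightarrow> z = z'"
  shows "absolute_winning UNIV
    {w. \<exists>\<gamma>>0. \<exists>\<rho>1>0. \<forall>\<rho>. 0 < \<rho> \<and> \<rho> < \<rho>1 \<longrightarrow> (\<forall>z\<in>Z \<rho>. \<gamma> * \<rho> < dist w z)}"
    (is "absolute_winning UNIV ?S")
  unfolding absolute_winning_def
proof (intro allI impI)
  fix \<beta>' :: real assume \<beta>': "0 < \<beta>' \<and> \<beta>' < 1"
  \<comment> \<open>The cap 1/4 guarantees that Bob always has a legal move; this is used when the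
    radii of a play do not tend to 0.\<close>
  define \<beta> where "\<beta> = min \<beta>' (1/4)"
  have \<beta>: "0 < \<beta>" "\<beta> \<le> 1/4" "\<beta> \<le> \<beta>'" using \<beta>' by (auto simp: \<beta>_def)
  \<comment> \<open>The default \<open>fst B\<close> merely supplies a legal centre when no
    dangerous point is near.\<close>
  define c where "c B = (if \<exists>z\<in>Z (snd B). dist (fst B) z \<le> 2 * snd B
      then SOME z. z \<in> Z (snd B) \<and> dist (fst B) z \<le> 2 * snd B else fst B)" for B
  define \<sigma> where "\<sigma> h = (c (last h), \<beta> * snd (last h))" for h
  have \<sigma>: "alice_strategy \<beta> UNIV \<sigma>"
    unfolding alice_strategy_def
  proof (intro allI impI)
    fix h :: "('a \<times> real) list"
    assume h: "h \<noteq> [] \<and> set h \<subseteq> game_balls_on UNIV"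
    then have "last h \<in> game_balls_on UNIV" by auto
    then show "\<sigma> h \<in> game_balls_on UNIV \<and> snd (\<sigma> h) \<le> \<beta> * snd (last h)"
      using \<beta> by (simp add: game_balls_on_def \<sigma>_def)
  qed
  have shrink: "w \<in> ?S"
    if B: "bob_play_against \<beta> UNIV \<sigma> B" and w: "\<And>k. w \<in> game_ball (B k)"
      and small: "\<And>e. 0 < e \<Longrightarrow> \<exists>k. snd (B k) < e" for B w
  proof -
    have pos: "0 < snd (B k)" for k using bob_play_radius_pos[OF B] .
    have avoid: "\<beta> * snd (B k) < dist w z" if "snd (B k) < \<rho>0" "z \<in> Z (snd (B k))" for k z
    proof (cases "dist (fst (B k)) z \<le> 2 * snd (B k)")
      case True
      let ?Q = "\<lambda>z. z \<in> Z (snd (B k)) \<and> dist (fst (B k)) z \<le> 2 * snd (B k)"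
      have "c (B k) = (SOME z. ?Q z)" using True that by (auto simp: c_def)
      moreover have "?Q (SOME z. ?Q z)" using True that by (intro someI[of ?Q z]) auto
      ultimately have "?Q (c (B k))" by simp
      \<comment> \<open>Both points lie within twice the radius of Bob's centre, hence within four
        times the radius of each other, where separation applies.\<close>
      then have "c (B k) = z"
        using sep[OF pos that(1), of "c (B k)" z] that(2) True
          dist_triangle3[of "c (B k)" z "fst (B k)"] by auto
      then have "\<sigma> (map B [0..<Suc k]) = (z, \<beta> * snd (B k))" by (simp add: \<sigma>_def)
      with w[of "Suc k"] B have "w \<notin> game_ball (z, \<beta> * snd (B k))"
        unfolding bob_play_against_def by (metis DiffD2 subsetD)
      then show ?thesis by (simp add: game_ball_def dist_commute)
    next
      case False
      have "dist (fst (B k)) w \<le> snd (B k)" using w[of k] by (simp add: game_ball_def)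
      moreover have "\<beta> * snd (B k) \<le> 1 * snd (B k)"
        using \<beta> pos[of k] by (intro mult_right_mono) auto
      ultimately show ?thesis using False dist_triangle[of "fst (B k)" z w] by linarith
    qed
    have "\<forall>\<rho>. 0 < \<rho> \<and> \<rho> < min \<rho>0 (snd (B 0)) \<longrightarrow> (\<forall>z\<in>Z \<rho>. \<beta>\<^sup>2 * \<rho> < dist w z)"
    proof (intro allI impI ballI)
      fix \<rho> z assume \<rho>: "0 < \<rho> \<and> \<rho> < min \<rho>0 (snd (B 0))" and z: "z \<in> Z \<rho>"
      \<comment> \<open>Take the first ball of radius below \<rho>. Its predecessor has radius at
        least \<rho>, so its own radius is at least \<open>\<beta> * \<rho>\<close>; the second
        factor \<beta> comes from \<open>avoid\<close>. The index is positive because \<rho> is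
        below the first radius.\<close>
      define k where "k = (LEAST k. snd (B k) < \<rho>)"
      have k: "snd (B k) < \<rho>" unfolding k_def using small[of \<rho>] \<rho> by (metis LeastI_ex)
      then obtain j where j: "k = Suc j" using \<rho> by (cases k) auto
      then have "\<not> snd (B j) < \<rho>" unfolding k_def using not_less_Least by (metis lessI)
      then have "\<beta> * \<rho> \<le> \<beta> * snd (B j)" using \<beta> by simp
      also have "\<dots> \<le> snd (B k)" using B j unfolding bob_play_against_def by blast
      finally have "\<beta>\<^sup>2 * \<rho> \<le> \<beta> * snd (B k)" using \<beta> by (simp add: power2_eq_square)
      also have "\<dots> < dist w z" using anti[OF pos, of k \<rho>] k z \<rho> by (intro avoid) auto
      finally show "\<beta>\<^sup>2 * \<rho> < dist w z" .
    qed
    moreover have "0 < min \<rho>0 (snd (B 0))" "0 < \<beta>\<^sup>2" using \<beta> \<open>0 < \<rho>0\<close> pos by auto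
    ultimately show ?thesis by blast
  qed
  have "(\<Inter>k. game_ball (B k)) \<inter> ?S \<noteq> {}" if B: "bob_play_against \<beta> UNIV \<sigma> B" for B
  proof (cases "\<forall>e>0. \<exists>k. snd (B k) < e")
    case True
    obtain w where w: "\<And>k. w \<in> game_ball (B k)"
      using bob_play_Inter_nonempty[OF B] by blast
    then have "w \<in> ?S" using True by (intro shrink[OF B]) simp_all
    then show ?thesis using w by (intro ex_in_conv[THEN iffD1] exI[of _ w]) simp
  next
    case False
    \<comment> \<open>The intersection contains a ball, inside which Bob can start a shrinking play.\<close>
    then obtain e where e: "0 < e" "\<And>k. e \<le> snd (B k)" by (meson not_le)
    have "(\<Inter>k. cball (fst (B k)) (snd (B k) - e)) \<noteq> {}"
    proof (intro compact_nest)
      show "cball (fst (B j)) (snd (B j) - e) \<subseteq> cball (fst (B i)) (snd (B i) - e)"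
        if "i \<le> j" for i j
        using bob_play_dist_centre[OF B that] e(2)[of j] by (simp add: cball_subset_cball_iff)
      show "cball (fst (B k)) (snd (B k) - e) \<noteq> {}" for k
        using e(2)[of k] by simp
    qed simp
    then obtain x where x: "\<And>k. dist (fst (B k)) x \<le> snd (B k) - e"
      unfolding ex_in_conv[symmetric] INT_iff mem_cball by blast
    have xe: "cball x e \<subseteq> game_ball (B k)" for k
      using x[of k] by (simp add: game_ball_def cball_subset_cball_iff dist_commute)
    obtain B' where B': "B' 0 = (x, e)" "bob_play_against \<beta> UNIV \<sigma> B'"
      "\<And>k. snd (B' k) = \<beta> ^ k * e"
    proof (rule bob_play_exists[OF \<sigma>, where P = "\<lambda>B. 0 < snd B" and ?B0.0 = "(x, e)"])
      show "\<exists>B'. 0 < snd B' \<and> game_ball B' \<subseteq> game_ball B - game_ball A \<and> snd B' = \<beta> * snd B"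
        if B: "0 < snd B" and A: "snd A \<le> \<beta> * snd B" for B A :: "'a \<times> real"
      proof -
        obtain y where "cball y (\<beta> * snd B) \<subseteq> cball (fst B) (snd B) - cball (fst A) (snd A)"
          using bob_can_avoid[OF \<beta>(1,2) B A] by metis
        then show ?thesis using B \<beta>
          by (intro exI[of _ "(y, \<beta> * snd B)"]) (auto simp: game_ball_def)
      qed
    qed (use e in \<open>auto simp: game_balls_on_def\<close>)
    obtain w where w: "\<And>k. w \<in> game_ball (B' k)"
      using bob_play_Inter_nonempty[OF B'(2)] by blast
    have "\<exists>k. snd (B' k) < t" if "0 < t" for t
    proof -
      obtain k where "\<beta> ^ k < t / e" using real_arch_pow_inv[of "t / e" \<beta>] \<beta> e \<open>0 < t\<close> by auto
      then show ?thesis using e by (auto simp: B' field_simps)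
    qed
    \<comment> \<open>\<open>B'\<close> does not continue \<open>B\<close>: it is a new play against
      the same \<open>\<sigma>\<close>. Its outcome lies in every ball of \<open>B\<close> because
      these all contain \<open>cball x e\<close>.\<close>
    then have "w \<in> ?S" by (rule shrink[OF B'(2) w])
    moreover have "w \<in> game_ball (B k)" for k
      using w[of 0] xe[of k] by (auto simp: B' game_ball_def)
    ultimately show ?thesis by (intro ex_in_conv[THEN iffD1] exI[of _ w]) simp
  qed
  then have "absolute_beta_winning \<beta> UNIV ?S"
    using \<sigma> unfolding absolute_beta_winning_def by blast
  then show "absolute_beta_winning \<beta>' UNIV ?S"
    using absolute_beta_winning_mono \<beta>(3) by blast
qed

section \<open>Badly \<open>\<alpha>\<close>-approximable vectors\<close>

lemma finite_int_vectors_bounded: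
  "finite {x \<in> int_vectors. norm (x :: real ^ 'k) \<le> R}"
proof -
  have "{x \<in> int_vectors. norm (x :: real ^ 'k) \<le> R}
      \<subseteq> (\<lambda>f. \<chi> i. of_int (f i)) ` (UNIV \<rightarrow>\<^sub>E {- \<lceil>R\<rceil>..\<lceil>R\<rceil>})"
  proof
    fix x :: "real ^ 'k" assume x: "x \<in> {x \<in> int_vectors. norm x \<le> R}"
    have "x = (\<chi> i. of_int \<lfloor>x $ i\<rfloor>)"
      using x by (auto simp: int_vectors_def vec_eq_iff)
    moreover have "\<lfloor>x $ i\<rfloor> \<in> {- \<lceil>R\<rceil>..\<lceil>R\<rceil>}" for i
      using component_le_norm_cart[of x i] x by simp linarith
    then have "(\<lambda>i. \<lfloor>x $ i\<rfloor>) \<in> UNIV \<rightarrow>\<^sub>E {- \<lceil>R\<rceil>..\<lceil>R\<rceil>}" by (simp add: PiE_UNIV_domain)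
    ultimately show "x \<in> (\<lambda>f. \<chi> i. of_int (f i)) ` (UNIV \<rightarrow>\<^sub>E {- \<lceil>R\<rceil>..\<lceil>R\<rceil>})"
      by (rule image_eqI)
  qed
  then show ?thesis by (rule finite_subset) (intro finite_imageI finite_PiE; simp)
qed

lemma int_vectors_norm_ge_1:
  assumes "x \<in> int_vectors" "x \<noteq> 0"
  shows "1 \<le> norm x"
proof -
  obtain i where "x $ i \<noteq> 0" using assms(2) by (auto simp: vec_eq_iff)
  then have "1 \<le> \<bar>x $ i\<bar>" using assms(1) by (intro Ints_nonzero_abs_ge1) (auto simp: int_vectors_def)
  then show ?thesis using component_le_norm_cart[of x i] by linarith
qed

lemma int_vectors_diff: "x \<in> int_vectors \<Longrightarrow> y \<in> int_vectors \<Longrightarrow> x - y \<in> int_vectors"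
  by (auto simp: int_vectors_def)

theorem absolute_winning_Tad:
  fixes \<alpha> :: "real ^ 'n ^ 'm"
  assumes "badly_approximable \<alpha>"
  shows "absolute_winning UNIV (Tad \<alpha>)"
proof -
  define e where "e = real CARD('n) / real CARD('m)"
  have e: "0 < e" by (simp add: e_def)
  obtain c where c: "0 < c" and bad: "\<And>p q. p \<in> int_vectors \<Longrightarrow> q \<in> int_vectors - {0} \<Longrightarrow>
      c * norm q powr (- e) < norm (\<alpha> *v q + p)"
    using assms unfolding badly_approximable_def e_def by blast
  \<comment> \<open>The condition bounds \<open>norm q\<close> by the T with
    \<open>4 * \<rho> * (2 * T) powr e = c\<close>. Two such q differ by a vector of norm at most
    2T, and bad approximability then separates the two points by more than
    \<open>c * (2 * T) powr (- e)\<close>, that is, by more than \<open>4 * \<rho>\<close>.\<close>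
  define Z where "Z \<rho> = {- (\<alpha> *v q + p) | p q. p \<in> int_vectors \<and> q \<in> int_vectors - {0} \<and>
      4 * \<rho> * (2 * norm q) powr e \<le> c}" for \<rho>
  have "absolute_winning UNIV
    {w. \<exists>\<gamma>>0. \<exists>\<rho>1>0. \<forall>\<rho>. 0 < \<rho> \<and> \<rho> < \<rho>1 \<longrightarrow> (\<forall>z\<in>Z \<rho>. \<gamma> * \<rho> < dist w z)}"
    (is "absolute_winning UNIV ?S")
  proof (rule absolute_winning_separated)
    show "Z \<rho>' \<subseteq> Z \<rho>" if "0 < \<rho>" "\<rho> \<le> \<rho>'" for \<rho> \<rho>'
    proof -
      have "4 * \<rho> * t \<le> c" if "4 * \<rho>' * t \<le> c" "0 \<le> t" for t
        using mult_right_mono[of "4 * \<rho>" "4 * \<rho>'" t] \<open>\<rho> \<le> \<rho>'\<close> that by simp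
      then show ?thesis by (fastforce simp: Z_def)
    qed
    show "z = z'" if \<rho>: "0 < \<rho>" "\<rho> < 1/8" and z: "z \<in> Z \<rho>" and z': "z' \<in> Z \<rho>"
      and d: "dist z z' \<le> 4 * \<rho>" for \<rho> z z'
    proof -
      obtain p q where pq: "z = - (\<alpha> *v q + p)" "p \<in> int_vectors" "q \<in> int_vectors - {0}"
        "4 * \<rho> * (2 * norm q) powr e \<le> c" using z by (auto simp: Z_def)
      obtain p' q' where pq': "z' = - (\<alpha> *v q' + p')" "p' \<in> int_vectors" "q' \<in> int_vectors - {0}"
        "4 * \<rho> * (2 * norm q') powr e \<le> c" using z' by (auto simp: Z_def)
      have diff: "dist z z' = norm (\<alpha> *v (q - q') + (p - p'))"
        unfolding pq(1) pq'(1) dist_norm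
        by (metis (no_types, lifting) add_diff_add matrix_vector_mult_diff_distrib minus_diff_minus norm_minus_cancel)
      show ?thesis
      \<comment> \<open>Bad approximability says nothing about a zero difference of the q. In that
        case the points differ by an integer vector, of norm less than 1 since \<rho> < 1/8, hence
        by 0.\<close>
      proof (cases "q = q'")
        case True
        show ?thesis
        proof (rule ccontr)
          assume "z \<noteq> z'"
          then have "p - p' \<noteq> 0" using True pq(1) pq'(1) by auto
          then have "1 \<le> norm (p - p')"
            using int_vectors_norm_ge_1 int_vectors_diff pq(2) pq'(2) by blast
          then show False using d \<rho> diff True by simp
        qed
      next
        case False
        have "norm (q - q') \<le> 2 * norm q \<or> norm (q - q') \<le> 2 * norm q'"
          using norm_triangle_ineq4[of q q'] by linarith
        then obtain t where t: "norm (q - q') \<le> t" "4 * \<rho> * t powr e \<le> c"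
          using pq(4) pq'(4) by blast
        have "4 * \<rho> * norm (q - q') powr e \<le> 4 * \<rho> * t powr e"
          using t(1) \<rho> e by (intro mult_left_mono powr_mono2) auto
        also note t(2)
        finally have "4 * \<rho> \<le> c * norm (q - q') powr (- e)"
          using False by (simp add: powr_minus field_simps)
        also have "\<dots> < dist z z'" unfolding diff
          using False pq pq' by (intro bad) (auto intro: int_vectors_diff)
        finally show ?thesis using d by simp
      qed
    qed
  qed simp
  moreover have "?S \<subseteq> Tad \<alpha>"
  proof
    fix w assume "w \<in> ?S"
    then obtain \<gamma> \<rho>1 where \<gamma>: "0 < \<gamma>" and \<rho>1: "0 < \<rho>1"
      and w: "\<And>\<rho> z. 0 < \<rho> \<Longrightarrow> \<rho> < \<rho>1 \<Longrightarrow> z \<in> Z \<rho> \<Longrightarrow> \<gamma> * \<rho> < dist w z" by blast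
    define k where "k = \<gamma> * (c / (4 * 2 powr e))"
    have k: "0 < k" using \<gamma> c by (simp add: k_def)
    \<comment> \<open>As soon as \<open>norm q\<close> exceeds \<open>R\<close>, the scale belonging
      to q is below \<open>\<rho>1\<close>, so the estimate for \<open>w\<close> excludes q. The
      remaining q are finite in number and bound p in turn.\<close>
    define R where "R = (c / (4 * \<rho>1)) powr (1 / e)"
    obtain K where K: "0 < K" "\<And>x. norm (\<alpha> *v x) \<le> norm x * K"
      using bounded_linear.pos_bounded[OF matrix_vector_mul_bounded_linear[of \<alpha>]] by blast
    let ?X = "{(p, q). p \<in> int_vectors \<and> q \<in> int_vectors - {0} \<and>
      norm (\<alpha> *v q + w + p) \<le> k * norm q powr (- e)}"
    have "?X \<subseteq> {p \<in> int_vectors. norm p \<le> k + R * K + norm w} \<times> {q \<in> int_vectors. norm q \<le> R}"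
    proof
      fix x assume "x \<in> ?X"
      then obtain p q where x: "x = (p, q)"
        and pq: "p \<in> int_vectors" "q \<in> int_vectors" "q \<noteq> 0"
        and le: "norm (\<alpha> *v q + w + p) \<le> k * norm q powr (- e)" by blast
      have q1: "1 \<le> norm q" using pq by (intro int_vectors_norm_ge_1)
      have R: "norm q \<le> R"
      proof (rule ccontr)
        assume "\<not> norm q \<le> R"
        then have "R powr e < norm q powr e" using e by (intro powr_less_mono2) (auto simp: R_def)
        then have "c / (4 * \<rho>1) < norm q powr e"
          using e c \<rho>1 by (simp add: R_def powr_powr)
        also have "\<dots> \<le> (2 * norm q) powr e" using e by (intro powr_mono2) auto
        finally have big: "c / (4 * \<rho>1) < (2 * norm q) powr e" .
        define \<rho> where "\<rho> = c / (4 * (2 * norm q) powr e)"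
        have qe: "0 < (2 * norm q) powr e" using pq by simp
        have "0 < \<rho>" using c qe by (simp add: \<rho>_def)
        moreover have "\<rho> < \<rho>1" using big \<rho>1 qe by (simp add: \<rho>_def field_simps)
        moreover have "- (\<alpha> *v q + p) \<in> Z \<rho>"
          unfolding Z_def using pq qe by (auto simp: \<rho>_def intro!: exI[of _ p] exI[of _ q])
        ultimately have "\<gamma> * \<rho> < dist w (- (\<alpha> *v q + p))" by (rule w)
        also have "\<dots> = norm (\<alpha> *v q + w + p)" by (simp add: dist_norm algebra_simps)
        also note le
        also have "k * norm q powr (- e) = \<gamma> * \<rho>"
          using q1 by (simp add: k_def \<rho>_def powr_mult powr_minus field_simps)
        finally show False by simp
      qed
      have "norm q powr (- e) \<le> 1" using q1 e by (simp add: powr_minus ge_one_powr_ge_zero inverse_le_1_iff)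
      then have "norm (\<alpha> *v q + w + p) \<le> k" using le k mult_left_le[of "norm q powr (- e)" k] by linarith
      moreover have "norm p \<le> norm (\<alpha> *v q + w + p) + norm (\<alpha> *v q + w)"
        using norm_triangle_ineq4[of "\<alpha> *v q + w + p" "\<alpha> *v q + w"] by simp
      moreover have "norm (\<alpha> *v q + w) \<le> norm (\<alpha> *v q) + norm w" by (rule norm_triangle_ineq)
      moreover have "norm (\<alpha> *v q) \<le> R * K"
        using K(2)[of q] mult_right_mono[OF R, of K] K(1) by linarith
      ultimately have "norm p \<le> k + R * K + norm w" by linarith
      then show "x \<in> {p \<in> int_vectors. norm p \<le> k + R * K + norm w} \<times>
          {q \<in> int_vectors. norm q \<le> R}"
        using pq R by (simp add: x)
    qed
    then have "finite ?X"
      by (rule finite_subset) (intro finite_cartesian_product finite_int_vectors_bounded)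
    then show "w \<in> Tad \<alpha>" using k unfolding Tad_def e_def by blast
  qed
  ultimately show ?thesis by (rule absolute_winning_mono)
qed

section \<open>Hausdorff measure\<close>

text \<open>The numbers \<open>r i\<close> only dominate the diameters, so they can be chosen
  positive. The mesh size does not appear because for s > 0 a small sum forces small
  diameters.\<close>

definition small_cover :: "real \<Rightarrow> real \<Rightarrow> 'a::metric_space set \<Rightarrow> (nat \<Rightarrow> 'a set) \<Rightarrow> (nat \<Rightarrow> real) \<Rightarrow> bool" where
  "small_cover s \<epsilon> X U r \<longleftrightarrow> X \<subseteq> (\<Union>i. U i) \<and>
     (\<forall>i. bounded (U i) \<and> diameter (U i) \<le> r i) \<and>
     (\<Sum>i. ennreal (r i powr s)) < ennreal \<epsilon>"

text \<open>Adding a geometric series of total \<epsilon>/2 to the s-th powers of the diameters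
  makes every \<open>r i\<close> positive. Positivity later lets Bob reach a ball smaller than a
  given covering set's bound.\<close>

lemma hausdorff_measure_eq_0_imp_small_cover:
  assumes "0 < s" "hausdorff_measure s X = 0" "0 < \<epsilon>"
  shows "\<exists>U r. small_cover s \<epsilon> X U r \<and> (\<forall>i. 0 < r i)"
proof -
  have "hausdorff_premeasure s 1 X \<le> hausdorff_measure s X"
    unfolding hausdorff_measure_def by (intro SUP_upper) simp
  then have "hausdorff_premeasure s 1 X < ennreal (\<epsilon> / 2)"
    using assms by (simp add: ennreal_zero_less_divide)
  then obtain U where X: "X \<subseteq> (\<Union>i. U i)" and U: "\<And>i. bounded (U i)"
    and sum: "(\<Sum>i. diameter_pow s (U i)) < ennreal (\<epsilon> / 2)"
    unfolding hausdorff_premeasure_def Inf_less_iff by blast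
  have diam: "0 \<le> diameter (U i)" for i using U diameter_ge_0 by blast
  have pow: "diameter_pow s (U i) = ennreal (diameter (U i) powr s)" for i
    using assms(1) by (simp add: diameter_pow_def)
  define w where "w i = diameter (U i) powr s + \<epsilon> / 2 * (1/2) ^ Suc i" for i
  have w: "0 < w i" "diameter (U i) powr s \<le> w i" for i
    using assms(3) by (auto simp: w_def intro: add_nonneg_pos)
  define r where "r i = w i powr (1 / s)" for i
  have r: "r i powr s = w i" "0 < r i" for i
    using w(1)[of i] assms(1) by (simp_all add: r_def powr_powr)
  have "diameter (U i) \<le> r i" for i
  proof -
    have "diameter (U i) = (diameter (U i) powr s) powr (1 / s)"
      using assms(1) diam by (simp add: powr_powr)
    also have "\<dots> \<le> r i" unfolding r_def using w(2) assms(1) by (intro powr_mono2) auto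
    finally show ?thesis .
  qed
  moreover have "(\<Sum>i. ennreal (r i powr s)) < ennreal \<epsilon>"
  proof -
    have "(\<lambda>i. \<epsilon> / 2 * (1/2) ^ Suc i) sums (\<epsilon> / 2 * 1)"
      by (intro sums_mult power_half_series)
    then have half: "(\<Sum>i. ennreal (\<epsilon> / 2 * (1/2) ^ Suc i)) = ennreal (\<epsilon> / 2)"
      using assms(3) by (intro suminf_ennreal_eq) auto
    have "(\<Sum>i. ennreal (r i powr s)) = (\<Sum>i. diameter_pow s (U i) + ennreal (\<epsilon> / 2 * (1/2) ^ Suc i))"
      using assms(3) by (simp add: r pow w_def ennreal_plus)
    also have "\<dots> = (\<Sum>i. diameter_pow s (U i)) + ennreal (\<epsilon> / 2)"
      by (subst suminf_add[symmetric]) (auto simp only: half intro: summableI)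
    also have "\<dots> < ennreal (\<epsilon> / 2) + ennreal (\<epsilon> / 2)"
      using sum by (simp add: ennreal_add_left_cancel_less add.commute)
    also have "\<dots> = ennreal \<epsilon>" using assms(3) by (simp flip: ennreal_plus)
    finally show ?thesis .
  qed
  ultimately have "small_cover s \<epsilon> X U r"
    using X U r by (simp add: small_cover_def)
  then show ?thesis using r(2) by blast
qed

lemma hausdorff_measure_eq_0I:
  assumes "0 < s" and cov: "\<And>\<epsilon>. 0 < \<epsilon> \<Longrightarrow> \<exists>U r. small_cover s \<epsilon> X U r"
  shows "hausdorff_measure s X = 0"
proof -
  have premeasure: "hausdorff_premeasure s \<delta> X \<le> 0 + ennreal \<epsilon>" if "0 < \<delta>" "0 < \<epsilon>" for \<delta> \<epsilon>
  proof -
    \<comment> \<open>Every term is at most the whole sum, so a sum below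
      \<open>\<delta> powr s\<close> forces all diameters below \<delta>.\<close>
    define t where "t = min \<epsilon> (\<delta> powr s)"
    have "0 < t" using that by (simp add: t_def)
    then obtain U r where "small_cover s t X U r" using cov by blast
    then have X: "X \<subseteq> (\<Union>i. U i)" and U: "\<And>i. bounded (U i)" "\<And>i. diameter (U i) \<le> r i"
      and sum: "(\<Sum>i. ennreal (r i powr s)) < ennreal t" unfolding small_cover_def by blast+
    have nonneg: "0 \<le> r i" for i using U[of i] diameter_ge_0[of "U i"] by linarith
    have "diameter (U i) \<le> \<delta>" for i
    proof -
      have "ennreal (r i powr s) < ennreal t" using sum by (rule ennreal_suminf_lessD)
      then have "r i powr s < \<delta> powr s" by (simp add: ennreal_less_iff t_def)
      then have "r i < \<delta>" using assms(1) that by (meson not_less powr_mono2 less_imp_le)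
      then show ?thesis using U(2)[of i] by linarith
    qed
    then have "hausdorff_premeasure s \<delta> X \<le> (\<Sum>i. diameter_pow s (U i))"
      unfolding hausdorff_premeasure_def using X U(1) by (intro Inf_lower) blast
    also have "\<dots> \<le> (\<Sum>i. ennreal (r i powr s))"
      using U assms(1) diameter_ge_0
      by (intro suminf_le) (auto simp: diameter_pow_def intro!: powr_mono2)
    also have "\<dots> \<le> ennreal t" using sum by simp
    also have "\<dots> \<le> ennreal \<epsilon>" by (simp add: t_def ennreal_leI)
    finally show ?thesis by simp
  qed
  have "hausdorff_premeasure s \<delta> X \<le> 0" if "0 < \<delta>" for \<delta>
  proof (rule ennreal_le_epsilon)
    show "hausdorff_premeasure s \<delta> X \<le> 0 + ennreal e" if "0 < e" for e
      by (fact premeasure[OF \<open>0 < \<delta>\<close> that])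
  qed
  then have "hausdorff_measure s X \<le> 0" unfolding hausdorff_measure_def by (intro SUP_least) auto
  then show ?thesis by simp
qed

lemma hausdorff_measure_null_UN:
  fixes X :: "nat \<Rightarrow> 'a::metric_space set"
  assumes "0 < s" "\<And>n. hausdorff_measure s (X n) = 0"
  shows "hausdorff_measure s (\<Union>n. X n) = 0"
proof (rule hausdorff_measure_eq_0I[OF assms(1)])
  fix \<epsilon> :: real assume \<epsilon>: "0 < \<epsilon>"
  \<comment> \<open>These budgets add up to \<epsilon>/2, which leaves room for the strict
    inequality.\<close>
  define t where "t n = \<epsilon> / 2 * (1/2) ^ Suc n" for n
  have t: "0 < t n" for n using \<epsilon> by (simp add: t_def)
  have "\<forall>n. \<exists>U r. small_cover s (t n) (X n) U r"
    using hausdorff_measure_eq_0_imp_small_cover[OF assms t] by blast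
  then obtain U r where c: "\<And>n. small_cover s (t n) (X n) (U n) (r n)" by metis
  define V where "V i = (case prod_decode i of (m, n) \<Rightarrow> U m n)" for i
  define q where "q i = (case prod_decode i of (m, n) \<Rightarrow> r m n)" for i
  have "(\<Union>n. X n) \<subseteq> (\<Union>i. V i)"
  proof
    fix x assume "x \<in> (\<Union>n. X n)"
    then obtain m n where "x \<in> U m n" using c unfolding small_cover_def by blast
    then have "x \<in> V (prod_encode (m, n))" by (simp add: V_def)
    then show "x \<in> (\<Union>i. V i)" by blast
  qed
  moreover have "bounded (V i) \<and> diameter (V i) \<le> q i" for i
    using c unfolding small_cover_def by (auto simp: V_def q_def split: prod.split)
  moreover have "(\<Sum>i. ennreal (q i powr s)) < ennreal \<epsilon>"
  proof -
    have "(\<Sum>i. ennreal (q i powr s)) = (\<Sum>i. (\<lambda>(m, n). ennreal (r m n powr s)) (prod_decode i))"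
      by (intro suminf_cong) (simp add: q_def split: prod.split)
    also have "\<dots> = (\<Sum>m. \<Sum>n. ennreal (r m n powr s))"
      by (rule suminf_ennreal_2dimen) simp
    also have "\<dots> \<le> (\<Sum>m. ennreal (t m))"
      using c unfolding small_cover_def by (intro suminf_le) (auto intro: less_imp_le)
    also have "\<dots> = ennreal (\<epsilon> / 2 * 1)"
      unfolding t_def using \<epsilon> by (intro suminf_ennreal_eq sums_mult power_half_series) auto
    also have "\<dots> < ennreal \<epsilon>" using \<epsilon> by (simp add: ennreal_less_iff)
    finally show ?thesis .
  qed
  ultimately show "\<exists>U r. small_cover s \<epsilon> (\<Union>n. X n) U r"
    unfolding small_cover_def by blast
qed

section \<open>Null sets and the Hausdorff dimension\<close>

lemma hausdorff_measure_empty: "hausdorff_measure s ({} :: 'a::metric_space set) = 0"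
proof -
  have "hausdorff_premeasure s \<delta> ({} :: 'a set) = 0" if "0 < \<delta>" for \<delta>
  proof -
    have "hausdorff_premeasure s \<delta> ({} :: 'a set) \<le> (\<Sum>i::nat. diameter_pow s ({} :: 'a set))"
      unfolding hausdorff_premeasure_def using that
      by (intro Inf_lower CollectI exI[of _ "\<lambda>_. {}"]) simp
    then show ?thesis by (simp add: diameter_pow_def)
  qed
  then show ?thesis by (simp add: hausdorff_measure_def SUP_eq_iff)
qed

lemma hausdorff_measure_null_subset:
  assumes "hausdorff_measure s Y = 0" "X \<subseteq> Y"
  shows "hausdorff_measure s X = 0"
proof -
  have "hausdorff_premeasure s \<delta> X \<le> hausdorff_premeasure s \<delta> Y" for \<delta>
    unfolding hausdorff_premeasure_def using assms(2) by (intro Inf_superset_mono) blast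
  then have "hausdorff_measure s X \<le> hausdorff_measure s Y"
    unfolding hausdorff_measure_def by (rule SUP_mono')
  then show ?thesis using assms(1) by simp
qed

text \<open>Every cover of a nonempty set has a nonempty member, whose weight is 1 by convention.
  This settles the exponent 0, which \<open>hausdorff_dim\<close> admits.\<close>

lemma hausdorff_measure_0_eq_0_imp_empty:
  assumes "hausdorff_measure 0 X = 0"
  shows "X = {}"
proof (rule ccontr)
  assume "X \<noteq> {}"
  have "1 \<le> hausdorff_premeasure 0 1 X"
    unfolding hausdorff_premeasure_def
  proof (intro Inf_greatest)
    fix y assume "y \<in> {\<Sum>i. diameter_pow 0 (U i) |U. X \<subseteq> \<Union> (range U) \<and> (\<forall>i. bounded (U i) \<and> diameter (U i) \<le> 1)}"
    then obtain U :: "nat \<Rightarrow> 'a set" where y: "y = (\<Sum>i. diameter_pow 0 (U i))" and U: "X \<subseteq> (\<Union>i. U i)" by blast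
    then obtain i where "U i \<noteq> {}" using \<open>X \<noteq> {}\<close> by blast
    then have "1 = (\<Sum>j\<in>{i}. diameter_pow 0 (U j))" by (simp add: diameter_pow_def)
    also have "\<dots> \<le> y" unfolding y by (intro sum_le_suminf summableI) auto
    finally show "1 \<le> y" .
  qed
  also have "\<dots> \<le> hausdorff_measure 0 X"
    unfolding hausdorff_measure_def by (intro SUP_upper) simp
  finally show False using assms by simp
qed

text \<open>The Lindelof property leaves countably many of the neighbourhoods, and countable unions
  of null sets are null.\<close>

lemma hausdorff_measure_locally_null:
  fixes X :: "'a::euclidean_space set"
  assumes "0 < s" and loc: "\<And>x. x \<in> X \<Longrightarrow> \<exists>T. open T \<and> x \<in> T \<and> hausdorff_measure s (X \<inter> T) = 0"
  shows "hausdorff_measure s X = 0"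
proof (cases "X = {}")
  case True
  then show ?thesis by (simp add: hausdorff_measure_empty)
next
  case False
  define \<F> where "\<F> = {T. open T \<and> hausdorff_measure s (X \<inter> T) = 0}"
  obtain \<G> where \<G>: "\<G> \<subseteq> \<F>" "countable \<G>" "\<Union>\<G> = \<Union>\<F>"
    using Lindelof[of \<F>] by (auto simp: \<F>_def)
  have X: "X \<subseteq> \<Union>\<G>" unfolding \<G>(3) using loc by (auto simp: \<F>_def)
  then have "\<G> \<noteq> {}" using False by auto
  then have "range (from_nat_into \<G>) = \<G>" using \<G>(2) by (rule range_from_nat_into)
  then have "X = (\<Union>n. X \<inter> from_nat_into \<G> n)" using X by (metis Int_Union Int_absorb2 image_image)
  moreover have "hausdorff_measure s (X \<inter> from_nat_into \<G> n) = 0" for n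
    using from_nat_into[OF \<open>\<G> \<noteq> {}\<close>, of n] \<G>(1) by (auto simp: \<F>_def)
  ultimately show ?thesis
    using hausdorff_measure_null_UN[OF assms(1), of "\<lambda>n. X \<inter> from_nat_into \<G> n"] by simp
qed

lemma hausdorff_dim_eqI:
  assumes "0 \<le> d"
    and null: "\<And>s. d < s \<Longrightarrow> hausdorff_measure s X = 0"
    and pos: "\<And>s. 0 < s \<Longrightarrow> s < d \<Longrightarrow> hausdorff_measure s X \<noteq> 0"
  shows "hausdorff_dim X = ereal d"
  unfolding hausdorff_dim_def
proof (rule antisym)
  show "Inf (ereal ` {s. 0 \<le> s \<and> hausdorff_measure s X = 0}) \<le> ereal d"
  proof (rule ereal_le_epsilon2)
    fix e :: real assume "0 < e"
    then show "Inf (ereal ` {s. 0 \<le> s \<and> hausdorff_measure s X = 0}) \<le> ereal d + ereal e"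
      using null[of "d + e"] \<open>0 \<le> d\<close> by (intro Inf_lower) auto
  qed
  show "ereal d \<le> Inf (ereal ` {s. 0 \<le> s \<and> hausdorff_measure s X = 0})"
  proof (intro Inf_greatest, clarify, rule ccontr)
    fix s assume s: "0 \<le> s" "hausdorff_measure s X = 0" and "\<not> ereal d \<le> ereal s"
    then have "s < d" by simp
    show False
    proof (cases "s = 0")
      \<comment> \<open>\<open>pos\<close> speaks of positive exponents only. A set that is null for
        exponent 0 is empty, hence null for d/2 too, against \<open>pos\<close>.\<close>
      case True
      then have X: "X = {}" using s(2) hausdorff_measure_0_eq_0_imp_empty by blast
      then show False
        using pos[of "d / 2"] True \<open>s < d\<close> by (simp add: hausdorff_measure_empty)
    next
      case False
      then show False using pos[of s] s \<open>s < d\<close> by simp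
    qed
  qed
qed

section \<open>Slices by subspaces\<close>

text \<open>The grid consists of the combinations of an orthonormal basis of \<open>L\<close> with
  integer coefficients in [-J, J]. Its covering property serves the upper bound for the dimension,
  its separation the lower bound. The factor \<open>dim L\<close> arises from bounding a norm by the
  sum of the coordinates.\<close>

lemma subspace_grid:
  fixes L :: "'a::euclidean_space set"
  assumes "subspace L"
  obtains G where "G \<subseteq> L" "finite G" "card G = (2 * J + 1) ^ dim L"
    "\<And>u. u \<in> G \<Longrightarrow> norm u \<le> real (dim L) * real J"
    "\<And>u v. u \<in> G \<Longrightarrow> v \<in> G \<Longrightarrow> u \<noteq> v \<Longrightarrow> 1 \<le> norm (u - v)"
    "\<And>x. x \<in> L \<Longrightarrow> norm x \<le> real J \<Longrightarrow> \<exists>u\<in>G. norm (x - u) \<le> real (dim L)"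
proof -
  obtain B where B: "B \<subseteq> L" "pairwise orthogonal B" "\<And>x. x \<in> B \<Longrightarrow> norm x = 1"
    "independent B" "card B = dim L" "span B = L"
    using orthonormal_basis_subspace[OF assms] by metis
  have fin: "finite B" using B(4) by (rule independent_imp_finite)
  define v :: "('a \<Rightarrow> real) \<Rightarrow> 'a" where "v f = (\<Sum>b\<in>B. f b *\<^sub>R b)" for f
  have coord: "v f \<bullet> b = f b" if "b \<in> B" for f b
  proof -
    have "v f \<bullet> b = (\<Sum>c\<in>B. f c * (c \<bullet> b))" by (simp add: v_def inner_sum_left)
    also have "\<dots> = (\<Sum>c\<in>B. if c = b then f c else 0)"
    proof (rule sum.cong[OF refl])
      fix c assume "c \<in> B"
      then show "f c * (c \<bullet> b) = (if c = b then f c else 0)"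
        using B(2) that B(3)[OF that]
        by (cases "c = b") (auto simp: pairwise_def orthogonal_def dot_square_norm)
    qed
    finally show ?thesis using fin that by simp
  qed
  have norm_v: "norm (v f) \<le> real (dim L) * t" if "\<And>b. b \<in> B \<Longrightarrow> \<bar>f b\<bar> \<le> t" for f t
  proof -
    have "norm (v f) \<le> (\<Sum>b\<in>B. norm (f b *\<^sub>R b))" unfolding v_def by (rule norm_sum)
    also have "\<dots> \<le> (\<Sum>b\<in>B. t)" using that B(3) by (intro sum_mono) simp
    finally show ?thesis by (simp add: B(5))
  qed
  have v_diff: "v f - v g = v (\<lambda>b. f b - g b)" for f g
    by (simp add: v_def sum_subtractf scaleR_left_diff_distrib)
  define I where "I = (B \<rightarrow>\<^sub>E {- int J..int J})"
  define G where "G = (\<lambda>f. v (\<lambda>b. of_int (f b))) ` I"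
  have sep: "1 \<le> norm (v (\<lambda>b. of_int (f b)) - v (\<lambda>b. of_int (g b)))"
    if fg: "f \<in> I" "g \<in> I" "f \<noteq> g" for f g
  proof -
    obtain b where b: "b \<in> B" "f b \<noteq> g b"
      using fg PiE_ext[of f B _ g] unfolding I_def by blast
    have "1 \<le> \<bar>of_int (f b) - of_int (g b) :: real\<bar>" using b(2) by linarith
    also have "\<dots> = \<bar>(v (\<lambda>b. of_int (f b)) - v (\<lambda>b. of_int (g b))) \<bullet> b\<bar>"
      using coord[OF b(1)] by (simp add: inner_diff_left)
    also have "\<dots> \<le> norm (v (\<lambda>b. of_int (f b)) - v (\<lambda>b. of_int (g b))) * norm b"
      by (rule Cauchy_Schwarz_ineq2)
    finally show ?thesis using B(3)[OF b(1)] by simp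
  qed
  then have "inj_on (\<lambda>f. v (\<lambda>b. of_int (f b))) I"
    by (intro inj_onI) (metis diff_self norm_zero not_one_le_zero)
  then have "card G = card I" unfolding G_def by (rule card_image)
  also have "\<dots> = (2 * J + 1) ^ dim L"
    unfolding I_def using fin by (simp add: card_PiE B(5) nat_add_distrib nat_mult_distrib algebra_simps)
  finally have card: "card G = (2 * J + 1) ^ dim L" .
  show thesis
  proof (rule that[OF _ _ card])
    show "G \<subseteq> L" using B(1) assms by (auto simp: G_def v_def intro!: subspace_sum subspace_mul)
    show "finite G" unfolding G_def I_def using fin by (intro finite_imageI finite_PiE) auto
    show "norm u \<le> real (dim L) * real J" if u: "u \<in> G" for u
    proof -
      obtain f where f: "f \<in> I" "u = v (\<lambda>b. of_int (f b))" using u by (auto simp: G_def)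
      have "\<bar>of_int (f b) :: real\<bar> \<le> real J" if "b \<in> B" for b
      proof -
        have "f b \<in> {- int J..int J}" using f(1) that unfolding I_def by (rule PiE_mem)
        then show ?thesis by auto
      qed
      then show ?thesis unfolding f(2) by (rule norm_v)
    qed
    show "1 \<le> norm (u - u')" if "u \<in> G" "u' \<in> G" "u \<noteq> u'" for u u'
      using that sep unfolding G_def by blast
    show "\<exists>u\<in>G. norm (x - u) \<le> real (dim L)" if x: "x \<in> L" "norm x \<le> real J" for x
    proof -
      \<comment> \<open>Rounding each coordinate down costs at most 1 per basis vector and stays in
        range, because the coordinates are at most J in absolute value.\<close>
      define f where "f = restrict (\<lambda>b. \<lfloor>x \<bullet> b\<rfloor>) B"
      have "\<lfloor>x \<bullet> b\<rfloor> \<in> {- int J..int J}" if "b \<in> B" for b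
      proof -
        have "\<bar>x \<bullet> b\<bar> \<le> real J" using Cauchy_Schwarz_ineq2[of x b] B(3)[OF that] x(2) by simp
        then show ?thesis by (auto simp: le_floor_iff floor_le_iff)
      qed
      then have "f \<in> I" by (simp add: f_def I_def)
      moreover have "x = v (\<lambda>b. x \<bullet> b)"
      proof -
        have "x \<in> span B" using x B(6) by simp
        then obtain u where u: "x = v u" unfolding span_finite[OF fin] v_def by auto
        show ?thesis unfolding u v_def[of "\<lambda>b. v u \<bullet> b"] by (simp add: coord) (simp add: v_def)
      qed
      then have "x - v (\<lambda>b. of_int (f b)) = v (\<lambda>b. x \<bullet> b - of_int (f b))" by (metis v_diff)
      moreover have "norm (v (\<lambda>b. x \<bullet> b - of_int (f b))) \<le> real (dim L) * 1"
      proof (rule norm_v)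
        show "\<bar>x \<bullet> b - of_int (f b)\<bar> \<le> 1" if "b \<in> B" for b
          using that by (simp add: f_def) linarith
      qed
      ultimately show ?thesis unfolding G_def by (intro bexI[of _ "v (\<lambda>b. of_int (f b))"]) auto
    qed
  qed
qed

text \<open>A grid of mesh r/J has at most (3J)^d points, with d the dimension of \<open>L\<close>.
  The pieces around them have images of diameter at most 2Kdr/J, so the sum of s-th powers is at
  most a constant times J^(d-s), which tends to 0.\<close>

lemma hausdorff_measure_lipschitz_slice_null:
  fixes g :: "'a::euclidean_space \<Rightarrow> 'b::euclidean_space"
  assumes "subspace L" "x0 \<in> L" "0 < r" "0 < K" "real (dim L) < s"
    and lip: "\<And>x y. x \<in> cball x0 r \<inter> L \<Longrightarrow> y \<in> cball x0 r \<inter> L \<Longrightarrow>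
      norm (g x - g y) \<le> K * norm (x - y)"
  shows "hausdorff_measure s (g ` (cball x0 r \<inter> L)) = 0"
proof (rule hausdorff_measure_eq_0I)
  define d where "d = dim L"
  show "0 < s" using assms(5) by linarith
  fix \<epsilon> :: real assume \<epsilon>: "0 < \<epsilon>"
  define C where "C = 3 ^ d * (2 * K * (d * r)) powr s"
  have "(\<lambda>J. C * real J powr (real d - s)) \<longlonglongrightarrow> C * 0"
    using assms(5) by (intro tendsto_mult tendsto_const tendsto_neg_powr filterlim_real_sequentially)
      (simp add: d_def)
  then have "eventually (\<lambda>J. C * real J powr (real d - s) < \<epsilon>) sequentially"
    using \<epsilon> by (simp add: order_tendstoD)
  then have "eventually (\<lambda>J. C * real J powr (real d - s) < \<epsilon> \<and> 1 \<le> J) sequentially"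
    using eventually_ge_at_top[of 1] by (rule eventually_conj)
  then obtain J :: nat where J: "C * real J powr (real d - s) < \<epsilon>" "1 \<le> J"
    unfolding eventually_sequentially by blast
  obtain G where G: "finite G" "card G = (2 * J + 1) ^ d"
    "\<And>x. x \<in> L \<Longrightarrow> norm x \<le> real J \<Longrightarrow> \<exists>u\<in>G. norm (x - u) \<le> real d"
    using subspace_grid[OF assms(1), of J] unfolding d_def by metis
  obtain h where h: "bij_betw h {..<card G} G"
    using G(1) ex_bij_betw_nat_finite lessThan_atLeast0 by metis
  define \<rho> where "\<rho> = r / real J"
  have \<rho>: "0 < \<rho>" "\<rho> * J = r" using assms(3) J(2) by (auto simp: \<rho>_def)
  define t where "t = 2 * K * (d * \<rho>)"
  have t: "0 \<le> t" using \<rho> assms(4) by (simp add: t_def)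
  \<comment> \<open>Covers are sequences, so the finite cover is padded with empty sets, whose bound
    0 contributes \<open>0 powr s = 0\<close>.\<close>
  define U where "U i = (if i < card G
    then g ` (cball x0 r \<inter> L \<inter> cball (x0 + \<rho> *\<^sub>R h i) (d * \<rho>)) else {})" for i
  define q where "q i = (if i < card G then t else 0)" for i
  have "g ` (cball x0 r \<inter> L) \<subseteq> (\<Union>i. U i)"
  proof clarify
    fix x assume x: "x \<in> cball x0 r" "x \<in> L"
    have "norm ((1 / \<rho>) *\<^sub>R (x - x0)) \<le> real J"
    proof -
      have "norm ((1 / \<rho>) *\<^sub>R (x - x0)) = dist x0 x / \<rho>"
        using \<rho>(1) by (simp add: dist_norm norm_minus_commute)
      also have "\<dots> \<le> real J" using x(1) \<rho> by (simp add: pos_divide_le_eq mult.commute)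
      finally show ?thesis .
    qed
    then obtain u where u: "u \<in> G" "norm ((1 / \<rho>) *\<^sub>R (x - x0) - u) \<le> real d"
      using G(3)[of "(1 / \<rho>) *\<^sub>R (x - x0)"] x(2) assms(1,2) by (auto simp: subspace_diff subspace_mul)
    have "x - (x0 + \<rho> *\<^sub>R u) = \<rho> *\<^sub>R ((1 / \<rho>) *\<^sub>R (x - x0) - u)"
      using \<rho> by (simp add: scaleR_right_diff_distrib)
    then have "norm (x - (x0 + \<rho> *\<^sub>R u)) = \<rho> * norm ((1 / \<rho>) *\<^sub>R (x - x0) - u)" using \<rho> by simp
    also have "\<dots> \<le> \<rho> * real d" using u(2) \<rho> by (intro mult_left_mono) auto
    finally have "x \<in> cball (x0 + \<rho> *\<^sub>R u) (d * \<rho>)" by (simp add: dist_norm norm_minus_commute mult.commute)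
    moreover have "u \<in> h ` {..<card G}" using u(1) bij_betw_imp_surj_on[OF h] by simp
    then obtain i where "u = h i" "i \<in> {..<card G}" by (rule imageE)
    ultimately have "g x \<in> U i" using x by (simp add: U_def)
    then show "g x \<in> (\<Union>i. U i)" by blast
  qed
  moreover have "bounded (U i) \<and> diameter (U i) \<le> q i" for i
  proof (cases "i < card G")
    case True
    have "norm (y - z) \<le> t" if yz: "y \<in> U i" "z \<in> U i" for y z
    proof -
      obtain a b where ab: "y = g a" "z = g b" "a \<in> cball x0 r \<inter> L" "b \<in> cball x0 r \<inter> L"
        "dist (x0 + \<rho> *\<^sub>R h i) a \<le> d * \<rho>" "dist (x0 + \<rho> *\<^sub>R h i) b \<le> d * \<rho>"
        using yz True unfolding U_def by auto
      have "norm (a - b) \<le> 2 * (d * \<rho>)"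
        using dist_triangle3[of a b "x0 + \<rho> *\<^sub>R h i"] ab(5,6) by (simp add: dist_norm)
      then have "K * norm (a - b) \<le> K * (2 * (d * \<rho>))" using assms(4) by (intro mult_left_mono) auto
      then show ?thesis using lip[OF ab(3,4)] unfolding ab(1,2) t_def by simp
    qed
    then show ?thesis using True t
      by (auto simp: q_def bounded_two_points dist_norm intro!: diameter_le)
  next
    case False
    then show ?thesis by (simp add: U_def q_def)
  qed
  moreover have "(\<Sum>i. ennreal (q i powr s)) < ennreal \<epsilon>"
  proof -
    have "(2 * J + 1) ^ d \<le> (3 * J) ^ d" using J(2) by (intro power_mono) auto
    then have "real (card G) \<le> real ((3 * J) ^ d)" unfolding G(2) of_nat_le_iff .
    then have "real (card G) * t powr s \<le> real ((3 * J) ^ d) * t powr s"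
      by (intro mult_right_mono) simp_all
    also have "\<dots> = C * real J powr (real d - s)"
    proof -
      have "t powr s = (2 * K * (d * r)) powr s * real J powr (- s)"
        using assms(3,4) J(2) by (simp add: t_def \<rho>_def powr_divide powr_minus_divide)
      then show ?thesis using J(2)
        by (simp add: C_def power_mult_distrib powr_diff powr_minus_divide powr_realpow)
    qed
    also note J(1)
    finally have "real (card G) * t powr s < \<epsilon>" .
    moreover have "(\<Sum>i. ennreal (q i powr s)) = (\<Sum>i<card G. ennreal (q i powr s))"
      using \<open>0 < s\<close> by (intro suminf_finite) (auto simp: q_def)
    then have "(\<Sum>i. ennreal (q i powr s)) = ennreal (real (card G) * t powr s)"
      by (simp add: q_def ennreal_mult ennreal_of_nat_eq_real_of_nat)
    ultimately show ?thesis by (simp add: ennreal_less_iff)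
  qed
  ultimately show "\<exists>U q. small_cover s \<epsilon> (g ` (cball x0 r \<inter> L)) U q"
    unfolding small_cover_def by blast
qed

section \<open>Absolute winning sets on slices: the lower bound\<close>

lemma sum_suminf_le_if_disjoint:
  fixes w :: "nat \<Rightarrow> real"
  assumes "summable w" "\<And>i. 0 \<le> w i" "finite G"
    and uniq: "\<And>i u v. u \<in> G \<Longrightarrow> v \<in> G \<Longrightarrow> R u i \<Longrightarrow> R v i \<Longrightarrow> u = v"
    and sub: "\<And>i u. u \<in> G \<Longrightarrow> R u i \<Longrightarrow> Q i"
  shows "(\<Sum>u\<in>G. \<Sum>i. if R u i then w i else 0) \<le> (\<Sum>i. if Q i then w i else 0)"
proof -
  have summ: "summable (\<lambda>i. if P i then w i else 0)" for P
    using assms(1) by (rule summable_comparison_test') (use assms(2) in auto)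
  have "(\<Sum>u\<in>G. \<Sum>i. if R u i then w i else 0) = (\<Sum>i. \<Sum>u\<in>G. if R u i then w i else 0)"
    by (rule suminf_sum[symmetric]) (rule summ)
  \<comment> \<open>After the interchange each index i is counted at most once, because at most one
    u in \<open>G\<close> is related to it.\<close>
  also have "\<dots> \<le> (\<Sum>i. if Q i then w i else 0)"
  proof (rule suminf_le)
    fix i
    show "(\<Sum>u\<in>G. if R u i then w i else 0) \<le> (if Q i then w i else 0)"
    proof (cases "\<exists>u\<in>G. R u i")
      case True
      then obtain u where u: "u \<in> G" "R u i" by blast
      then have "(\<Sum>v\<in>G. if R v i then w i else 0) = (\<Sum>v\<in>G. if v = u then w i else 0)"
        using uniq by (intro sum.cong) auto
      then show ?thesis using u sub assms(2,3) by simp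
    next
      case False
      then have "(\<Sum>u\<in>G. if R u i then w i else 0) = 0" by (intro sum.neutral) auto
      then show ?thesis using assms(2) by simp
    qed
  qed (intro summable_sum summ, rule summ)
  finally show ?thesis .
qed

text \<open>J^d outgrows J^s since s < d. On the left stands the s-th power of the ratio N of Bob's
  consecutive radii, on the right the number of candidates that survive when Alice destroys
  one.\<close>

lemma grid_size_exists:
  fixes K s :: real
  assumes "1 \<le> K" "0 < s" "s < real d"
  obtains J :: nat where "1 \<le> J"
    "(5 * K\<^sup>2 * real d * real J + 1) powr s \<le> real ((2 * J + 1) ^ d) - 1"
proof -
  \<comment> \<open>For J \<ge> 1 the factor \<open>C\<close> absorbs the summand 1 on the left, and
    the extra 1 in \<open>C powr s + 1\<close> pays for the subtracted 1 on the right.\<close>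
  define C where "C = 5 * K\<^sup>2 * real d + 1"
  have C: "0 < C" by (simp add: C_def add_nonneg_pos)
  have "(\<lambda>J. (C powr s + 1) * real J powr (s - real d)) \<longlonglongrightarrow> (C powr s + 1) * 0"
    using assms(3) by (intro tendsto_mult tendsto_const tendsto_neg_powr filterlim_real_sequentially) simp
  then have "eventually (\<lambda>J. (C powr s + 1) * real J powr (s - real d) < 1) sequentially"
    by (simp add: order_tendstoD)
  then have "eventually (\<lambda>J. (C powr s + 1) * real J powr (s - real d) < 1 \<and> 1 \<le> J) sequentially"
    using eventually_ge_at_top[of 1] by (rule eventually_conj)
  then obtain J :: nat where J: "(C powr s + 1) * real J powr (s - real d) < 1" "1 \<le> J"
    unfolding eventually_sequentially by blast
  have "(5 * K\<^sup>2 * real d * real J + 1) powr s \<le> (C * real J) powr s"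
    using J(2) assms by (intro powr_mono2) (auto simp: C_def algebra_simps)
  moreover have "1 \<le> real J powr s" using J(2) assms(2) by (intro ge_one_powr_ge_zero) auto
  moreover have "(C powr s + 1) * real J powr s \<le> real (J ^ d)"
  proof -
    have "real J powr s = real J powr (s - real d) * real (J ^ d)"
      using J(2) by (simp flip: powr_realpow powr_add)
    then have "(C powr s + 1) * real J powr s =
        (C powr s + 1) * real J powr (s - real d) * real (J ^ d)" by simp
    also have "\<dots> \<le> 1 * real (J ^ d)" using J(1) by (intro mult_right_mono) auto
    finally show ?thesis by simp
  qed
  moreover have "real (J ^ d) \<le> real ((2 * J + 1) ^ d)"
    unfolding of_nat_le_iff by (intro power_mono) auto
  ultimately have "(5 * K\<^sup>2 * real d * real J + 1) powr s \<le> real ((2 * J + 1) ^ d) - 1"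
    using C by (simp add: powr_mult algebra_simps)
  then show thesis using that J(2) by blast
qed

text \<open>A parameter ball of radius \<eta> about \<open>x\<close> corresponds to Bob's ball of
  radius \<open>K * \<eta>\<close> about \<open>g x\<close>. The bound \<open>up\<close> keeps the
  candidates inside Bob's ball, and \<open>lo\<close> keeps them apart.\<close>

theorem absolute_winning_slice_not_null:
  fixes g :: "'b::euclidean_space \<Rightarrow> 'a::euclidean_space"
  assumes win: "absolute_winning UNIV S"
    and L: "subspace L" "x0 \<in> L" and "0 < r" and K: "1 \<le> K"
    and up: "\<And>x y. x \<in> cball x0 r \<inter> L \<Longrightarrow> y \<in> cball x0 r \<inter> L \<Longrightarrow>
      norm (g x - g y) \<le> K * norm (x - y)"
    and lo: "\<And>x y. x \<in> cball x0 r \<inter> L \<Longrightarrow> y \<in> cball x0 r \<inter> L \<Longrightarrow>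
      norm (x - y) \<le> K * norm (g x - g y)"
    and s: "0 < s" "s < real (dim L)"
  shows "hausdorff_measure s (g ` (cball x0 r \<inter> L) \<inter> S) \<noteq> 0"
proof
  assume null: "hausdorff_measure s (g ` (cball x0 r \<inter> L) \<inter> S) = 0"
  define D where "D = cball x0 r \<inter> L"
  define d where "d = dim L"
  have "1 \<le> d" using s by (cases "dim L") (auto simp: d_def)
  obtain J where J: "1 \<le> J"
    "(5 * K\<^sup>2 * real d * real J + 1) powr s \<le> real ((2 * J + 1) ^ d) - 1"
    using grid_size_exists[OF K s] unfolding d_def by blast
  \<comment> \<open>With l = \<eta>/N the candidates have parameters x + 5K^2 l u, at distance at
    most 5K^2 d J l = \<eta> - l from x. Hence their parameter balls of radius l fit into the one of
    radius \<eta>.\<close>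
  define N where "N = 5 * K\<^sup>2 * real d * real J + 1"
  have "1 < N" unfolding N_def using K \<open>1 \<le> d\<close> J(1) by (simp add: zero_less_mult_iff)
  obtain G where G: "G \<subseteq> L" "finite G" "card G = (2 * J + 1) ^ d"
    "\<And>u. u \<in> G \<Longrightarrow> norm u \<le> real d * real J"
    "\<And>u v. u \<in> G \<Longrightarrow> v \<in> G \<Longrightarrow> u \<noteq> v \<Longrightarrow> 1 \<le> norm (u - v)"
    using subspace_grid[OF L(1), of J] unfolding d_def by metis
  have "absolute_beta_winning (1 / N) UNIV S"
    using win \<open>1 < N\<close> unfolding absolute_winning_def by simp
  then obtain \<sigma> where \<sigma>: "alice_strategy (1 / N) UNIV \<sigma>"
    and \<sigma>win: "\<And>B. bob_play_against (1 / N) UNIV \<sigma> B \<Longrightarrow> (\<Inter>k. game_ball (B k)) \<inter> S \<noteq> {}"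
    unfolding absolute_beta_winning_def by blast
  \<comment> \<open>This is the weight that \<open>P\<close> allows for the first ball, of radius
    \<open>K * r\<close>; the whole cover is chosen lighter than that.\<close>
  have \<epsilon>: "0 < (K * r / N) powr s" using K \<open>0 < r\<close> \<open>1 < N\<close> by simp
  obtain U q where cov: "small_cover s ((K * r / N) powr s) (g ` D \<inter> S) U q" and q: "\<And>i. 0 < q i"
    using hausdorff_measure_eq_0_imp_small_cover[OF s(1) null \<epsilon>] unfolding D_def by blast
  have DU: "g ` D \<inter> S \<subseteq> (\<Union>i. U i)" and U: "\<And>i. bounded (U i)" "\<And>i. diameter (U i) \<le> q i"
    and qsum: "(\<Sum>i. ennreal (q i powr s)) < ennreal ((K * r / N) powr s)"
    using cov unfolding small_cover_def by blast+
  define w where "w i = q i powr s" for i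
  have w: "0 \<le> w i" for i by (simp add: w_def)
  have wtop: "(\<Sum>i. ennreal (w i)) \<noteq> top" using qsum unfolding w_def by (metis ennreal_less_top less_trans less_irrefl)
  have wsum: "summable w" using w wtop by (rule summable_suminf_not_top)
  have wlt: "suminf w < (K * r / N) powr s"
    using qsum suminf_ennreal[OF w wtop] suminf_nonneg[OF wsum w]
    by (simp add: ennreal_less_iff flip: w_def)
  have summ: "summable (\<lambda>i. if P i then w i else 0)" for P
    using wsum by (rule summable_comparison_test') (use w in auto)
  define hit where "hit B i \<longleftrightarrow> U i \<inter> game_ball B \<noteq> {}" for B :: "'a \<times> real" and i
  define \<Phi> where "\<Phi> B = (\<Sum>i. if hit B i then w i else 0)" for B
  have small: "q i < \<rho> / N" if "hit B i" "\<Phi> B < (\<rho> / N) powr s" "0 < \<rho>" for B i \<rho>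
  proof -
    have "w i \<le> \<Phi> B"
      using sum_le_suminf[OF summ[of "hit B"], of "{i}"] that(1) w by (simp add: \<Phi>_def)
    then have "q i powr s < (\<rho> / N) powr s" using that(2) by (simp add: w_def)
    show ?thesis
    proof (rule ccontr)
      assume "\<not> q i < \<rho> / N"
      then have "(\<rho> / N) powr s \<le> q i powr s"
        using s(1) that(3) \<open>1 < N\<close> by (intro powr_mono2) auto
      with \<open>q i powr s < _\<close> show False by simp
    qed
  qed
  \<comment> \<open>Bob keeps the total weight of the covering sets that meet his ball of radius \<open>\<rho>\<close> below
    \<open>(\<rho> / N)\<^sup>s\<close>, so that each of them is smaller than his next ball and, like Alice's ball,
    meets at most one of the candidates for it.\<close>
  define P where "P B \<longleftrightarrow> (\<exists>x \<eta>. B = (g x, K * \<eta>) \<and> 0 < \<eta> \<and> x \<in> L \<and> dist x x0 + \<eta> \<le> r \<and>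
      \<Phi> B < (K * \<eta> / N) powr s)" for B
  have step: "\<exists>B'. P B' \<and> game_ball B' \<subseteq> game_ball B - game_ball A \<and> snd B' = (1 / N) * snd B"
    if PB: "P B" and A: "snd A \<le> (1 / N) * snd B" for B A
  proof -
    obtain x \<eta> where B: "B = (g x, K * \<eta>)" and \<eta>: "0 < \<eta>" and x: "x \<in> L" "dist x x0 + \<eta> \<le> r"
      and \<Phi>B: "\<Phi> B < (K * \<eta> / N) powr s" using PB unfolding P_def by blast
    define l where "l = \<eta> / N"
    have l: "0 < l" "N * l = \<eta>" using \<eta> \<open>1 < N\<close> by (simp_all add: l_def)
    define y where "y u = x + (5 * K\<^sup>2 * l) *\<^sub>R u" for u
    define child where "child u = (g (y u), K * l)" for u
    have xD: "x \<in> D" using x \<eta> by (simp add: D_def dist_commute)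
    have yx: "dist (y u) x \<le> \<eta> - l" if "u \<in> G" for u
    proof -
      have "dist (y u) x = 5 * K\<^sup>2 * l * norm u" using l by (simp add: y_def dist_norm)
      also have "\<dots> \<le> 5 * K\<^sup>2 * l * (real d * real J)"
        using G(4)[OF that] l by (intro mult_left_mono) auto
      also have "\<dots> = N * l - l" by (simp add: N_def algebra_simps)
      finally show ?thesis using l by simp
    qed
    have yr: "dist (y u) x0 + l \<le> r" if "u \<in> G" for u
      using yx[OF that] x(2) dist_triangle[of "y u" x0 x] by linarith
    have yL: "y u \<in> L" if "u \<in> G" for u
      using that G(1) x(1) L(1) by (auto simp: y_def intro!: subspace_add subspace_mul)
    have yD: "y u \<in> D" if "u \<in> G" for u
      using yr[OF that] yL[OF that] l by (simp add: D_def dist_commute)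
    have child_sub: "game_ball (child u) \<subseteq> game_ball B" if "u \<in> G" for u
    proof -
      have "dist (g (y u)) (g x) \<le> K * dist (y u) x"
        using up yD[OF that] xD unfolding D_def by (simp add: dist_norm)
      also have "\<dots> \<le> K * (\<eta> - l)" using yx[OF that] K by (intro mult_left_mono) auto
      finally show ?thesis
        by (simp add: child_def B game_ball_def cball_subset_cball_iff algebra_simps)
    qed
    have far: "5 * (K * l) \<le> dist (g (y u)) (g (y v))" if "u \<in> G" "v \<in> G" "u \<noteq> v" for u v
    proof -
      have "y u - y v = (5 * K\<^sup>2 * l) *\<^sub>R (u - v)" by (simp add: y_def algebra_simps)
      then have "norm (y u - y v) = 5 * K\<^sup>2 * l * norm (u - v)" using l by simp
      moreover have "5 * K\<^sup>2 * l * 1 \<le> 5 * K\<^sup>2 * l * norm (u - v)"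
        using G(5)[OF that] l by (intro mult_left_mono) auto
      ultimately have "K * (5 * (K * l)) \<le> norm (y u - y v)" by (simp add: power2_eq_square mult_ac)
      also have "\<dots> \<le> K * norm (g (y u) - g (y v))"
        using lo yD that unfolding D_def by blast
      finally show ?thesis using K by (simp add: dist_norm)
    qed
    \<comment> \<open>A set of diameter at most 2Kl that met two children of radius Kl would bring
      their centres within 4Kl, but these are at least 5Kl apart. This applies to Alice's ball, of
      radius at most Kl, and to each covering set that meets a child.\<close>
    have uniq: "u = v"
      if uv: "u \<in> G" "v \<in> G" "W \<inter> game_ball (child u) \<noteq> {}" "W \<inter> game_ball (child v) \<noteq> {}"
        and W: "\<And>a b. a \<in> W \<Longrightarrow> b \<in> W \<Longrightarrow> dist a b \<le> 2 * (K * l)" for W u v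
    proof (rule ccontr)
      assume "u \<noteq> v"
      obtain a b where ab: "a \<in> W" "b \<in> W" "dist (g (y u)) a \<le> K * l" "dist (g (y v)) b \<le> K * l"
        using uv(3,4) by (auto simp: child_def game_ball_def)
      have "dist (g (y u)) (g (y v)) \<le> dist (g (y u)) a + dist a b + dist b (g (y v))"
        using dist_triangle[of "g (y u)" "g (y v)" a] dist_triangle[of a "g (y v)" b] by linarith
      then have "5 * (K * l) \<le> 4 * (K * l)"
        using far[OF uv(1,2) \<open>u \<noteq> v\<close>] W[OF ab(1,2)] ab(3,4) by (simp add: dist_commute)
      then show False using K l by simp
    qed
    define G' where "G' = {u \<in> G. game_ball A \<inter> game_ball (child u) = {}}"
    have "card (G - G') \<le> 1"
    proof -
      have "u = v" if "u \<in> G - G'" "v \<in> G - G'" for u v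
      proof (rule uniq[where W = "game_ball A"])
        fix a b assume "a \<in> game_ball A" "b \<in> game_ball A"
        then have "dist (fst A) a \<le> snd A" "dist (fst A) b \<le> snd A" by (auto simp: game_ball_def)
        moreover have "snd A \<le> K * l" using A by (simp add: B l_def)
        ultimately show "dist a b \<le> 2 * (K * l)"
          using dist_triangle3[of a b "fst A"] by linarith
      qed (use that in \<open>auto simp: G'_def\<close>)
      then show ?thesis using G(2) by (simp add: card_le_Suc0_iff_eq)
    qed
    moreover have "G' \<subseteq> G" by (auto simp: G'_def)
    ultimately have "card G \<le> card G' + 1"
      using G(2) by (simp add: card_Diff_subset finite_subset)
    then have cardG': "N powr s \<le> real (card G')"
      using J(2) unfolding N_def[symmetric] G(3)[symmetric] by linarith
    \<comment> \<open>Averaging: if all surviving children were too heavy, their weights would sum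
      to at least N^s (Kl/N)^s = (K\<eta>/N)^s. As no covering set is counted twice, that sum is at
      most \<open>\<Phi> B\<close>, which is smaller.\<close>
    have "\<exists>u\<in>G'. \<Phi> (child u) < (K * l / N) powr s"
    proof (rule ccontr)
      assume "\<not> ?thesis"
      then have ge: "(K * l / N) powr s \<le> \<Phi> (child u)" if "u \<in> G'" for u using that by force
      have "(K * \<eta> / N) powr s = N powr s * (K * l / N) powr s"
        using K l \<open>1 < N\<close> by (simp add: l(2)[symmetric] flip: powr_mult)
      also have "\<dots> \<le> real (card G') * (K * l / N) powr s"
        using cardG' by (intro mult_right_mono) auto
      also have "\<dots> \<le> (\<Sum>u\<in>G'. \<Phi> (child u))" using ge sum_mono[of G' "\<lambda>_. (K * l / N) powr s"] by simp
      also have "\<dots> \<le> (\<Sum>i. if hit B i then w i else 0)" unfolding \<Phi>_def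
      proof (rule sum_suminf_le_if_disjoint[OF wsum w])
        show "finite G'" using G(2) \<open>G' \<subseteq> G\<close> by (rule finite_subset[rotated])
        show hit: "hit B i" if "u \<in> G'" "hit (child u) i" for i u
          using that child_sub[of u] \<open>G' \<subseteq> G\<close> unfolding hit_def by blast
        show "u = v" if uv: "u \<in> G'" "v \<in> G'" "hit (child u) i" "hit (child v) i" for i u v
        proof (rule uniq[where W = "U i"])
          fix a b assume "a \<in> U i" "b \<in> U i"
          then have "dist a b \<le> q i" using diameter_bounded_bound[OF U(1)] U(2) by (meson order_trans)
          also have "q i < K * \<eta> / N" using small[OF hit[OF uv(1,3)] \<Phi>B] K \<eta> by simp
          finally have "dist a b < K * l" by (simp add: l_def)
          moreover have "0 < K * l" using K l by simp
          ultimately show "dist a b \<le> 2 * (K * l)" by linarith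
        qed (use uv \<open>G' \<subseteq> G\<close> in \<open>auto simp: hit_def\<close>)
      qed
      also have "\<dots> < (K * \<eta> / N) powr s" using \<Phi>B by (simp add: \<Phi>_def)
      finally show False by simp
    qed
    then obtain u where u: "u \<in> G'" "\<Phi> (child u) < (K * l / N) powr s" by blast
    then have uG: "u \<in> G" by (simp add: G'_def)
    have "P (child u)"
      unfolding P_def using u(2) yL[OF uG] yr[OF uG] l(1) by (auto simp: child_def)
    moreover have "game_ball (child u) \<subseteq> game_ball B - game_ball A"
      using child_sub[OF uG] u(1) by (auto simp: G'_def)
    moreover have "snd (child u) = (1 / N) * snd B" by (simp add: child_def B l_def)
    ultimately show ?thesis by blast
  qed
  obtain B where PB: "\<And>k. P (B k)" and play: "bob_play_against (1 / N) UNIV \<sigma> B"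
    and rad: "\<And>k. snd (B k) = (1 / N) ^ k * (K * r)"
  proof (rule bob_play_exists[OF \<sigma>, where P = P and ?B0.0 = "(g x0, K * r)"])
    have "\<Phi> (g x0, K * r) \<le> suminf w" unfolding \<Phi>_def
      using w by (intro suminf_le summ wsum) auto
    then have "\<Phi> (g x0, K * r) < (K * r / N) powr s" using wlt by linarith
    then show "P (g x0, K * r)"
      unfolding P_def using L(2) \<open>0 < r\<close> by (intro exI[of _ x0] exI[of _ r]) simp
    show "B \<in> game_balls_on UNIV" if "P B" for B
      using that K by (auto simp: P_def game_balls_on_def)
  qed (use step in auto)
  have shrink: "\<exists>k. snd (B k) < e" if e: "0 < e" for e
  proof -
    have Kr: "0 < K * r" using K \<open>0 < r\<close> by simp
    obtain k where "(1 / N) ^ k < e / (K * r)"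
      using real_arch_pow_inv[of "e / (K * r)" "1 / N"] e Kr \<open>1 < N\<close> by auto
    then have "snd (B k) < e" using Kr unfolding rad by (simp add: pos_less_divide_eq)
    then show ?thesis ..
  qed
  obtain z where z: "\<And>k. z \<in> game_ball (B k)" "z \<in> S" using \<sigma>win[OF play] by blast
  have "K-lipschitz_on D g"
    using up K unfolding D_def by (intro lipschitz_onI) (auto simp: dist_norm)
  then have "continuous_on D g" by (rule lipschitz_on_continuous_on)
  then have "compact (g ` D)"
    using closed_subspace[OF L(1)] unfolding D_def
    by (intro compact_continuous_image compact_Int_closed) auto
  then have "closed (g ` D)" by (rule compact_imp_closed)
  moreover have "z \<in> closure (g ` D)"
    unfolding closure_approachable
  proof (intro allI impI)
    fix e :: real assume "0 < e"
    then obtain k where k: "snd (B k) < e" using shrink by blast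
    have "fst (B k) \<in> g ` D" using PB[of k] by (auto simp: P_def D_def dist_commute)
    moreover have "dist (fst (B k)) z < e" using z(1)[of k] k by (simp add: game_ball_def)
    ultimately show "\<exists>y\<in>g ` D. dist y z < e" by blast
  qed
  ultimately have "z \<in> g ` D" by (simp add: closure_closed)
  then obtain i where i: "z \<in> U i" using z(2) DU by blast
  \<comment> \<open>The set \<open>U i\<close> contains z and thus meets every ball of Bob, so the
    invariant keeps \<open>q i\<close> below each radius; but the radii tend to 0 and
    \<open>q i\<close> is positive.\<close>
  obtain k where k: "snd (B k) < q i" using shrink[OF q] by blast
  have "hit (B k) i" using i z(1) by (auto simp: hit_def)
  moreover obtain x \<eta> where \<eta>: "B k = (g x, K * \<eta>)" "0 < \<eta>" "\<Phi> (B k) < (K * \<eta> / N) powr s"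
    using PB[of k] unfolding P_def by blast
  moreover have K\<eta>: "0 < K * \<eta>" using \<eta>(2) K by simp
  ultimately have "q i < K * \<eta> / N" using small by blast
  also have "\<dots> < K * \<eta>" using mult_strict_left_mono[OF \<open>1 < N\<close> K\<eta>] \<open>1 < N\<close> by (simp add: divide_less_eq)
  finally show False using k \<eta>(1) by simp
qed

section \<open>Submanifolds\<close>

text \<open>The continuous derivative is bounded on a compact ball, and the mean value inequality
  applies because the ball is convex.\<close>

lemma C1_on_locally_lipschitz:
  fixes f :: "'a::euclidean_space \<Rightarrow> 'b::euclidean_space"
  assumes "C1_on f U" "open U" "x \<in> U"
  obtains r K where "0 < r" "0 < K" "cball x r \<subseteq> U"
    "\<And>y z. y \<in> cball x r \<Longrightarrow> z \<in> cball x r \<Longrightarrow> norm (f y - f z) \<le> K * norm (y - z)"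
proof -
  obtain f' :: "'a \<Rightarrow> 'a \<Rightarrow>\<^sub>L 'b" where
    f': "\<And>x. x \<in> U \<Longrightarrow> (f has_derivative blinfun_apply (f' x)) (at x)" and cont: "continuous_on U f'"
    using assms(1) unfolding C1_on_def by blast
  obtain r where r: "0 < r" "cball x r \<subseteq> U"
    using assms(2,3) open_contains_cball by blast
  have "compact (f' ` cball x r)"
    using continuous_on_subset[OF cont r(2)] by (intro compact_continuous_image) auto
  then obtain K where K: "0 < K" "\<And>y. y \<in> cball x r \<Longrightarrow> norm (f' y) \<le> K"
    using compact_imp_bounded bounded_pos by (metis imageI)
  have "norm (f y - f z) \<le> K * norm (y - z)" if "y \<in> cball x r" "z \<in> cball x r" for y z
  proof (rule differentiable_bound[OF convex_cball _ _ that])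
    show "(f has_derivative blinfun_apply (f' w)) (at w within cball x r)" if "w \<in> cball x r" for w
    proof -
      have "w \<in> U" using r(2) that by blast
      from f'[OF this] show ?thesis by (rule has_derivative_at_withinI)
    qed
    show "onorm (blinfun_apply (f' w)) \<le> K" if "w \<in> cball x r" for w
      using K(2)[OF that] by (simp add: norm_blinfun.rep_eq)
  qed
  then show thesis by (rule that[OF r(1) K(1) r(2)])
qed

text \<open>The parametrization \<open>g\<close> is the inverse chart \<psi> near
  \<open>\<phi> x\<close>. The two Lipschitz bounds are those of \<psi> and of \<phi>, both locally
  Lipschitz as C1 maps.\<close>

lemma C1_submanifold_local_parametrization:
  fixes M :: "'a::euclidean_space set"
  assumes "C1_submanifold d M" "x \<in> M"
  obtains L :: "'a set" and g :: "'a \<Rightarrow> 'a" and x0 r K T where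
    "subspace L" "dim L = d" "x0 \<in> L" "0 < r" "1 \<le> K"
    "\<And>y z. y \<in> cball x0 r \<inter> L \<Longrightarrow> z \<in> cball x0 r \<inter> L \<Longrightarrow> norm (g y - g z) \<le> K * norm (y - z)"
    "\<And>y z. y \<in> cball x0 r \<inter> L \<Longrightarrow> z \<in> cball x0 r \<inter> L \<Longrightarrow> norm (y - z) \<le> K * norm (g y - g z)"
    "open T" "x \<in> T" "M \<inter> T \<subseteq> g ` (cball x0 r \<inter> L)" "g ` (cball x0 r \<inter> L) \<subseteq> M"
proof -
  obtain U V :: "'a set" and \<phi> \<psi> L where
    UV: "open U" "x \<in> U" "open V" "homeomorphism U V \<phi> \<psi>" "C1_on \<phi> U" "C1_on \<psi> V"
    and L: "subspace L" "dim L = d" and slice: "\<phi> ` (U \<inter> M) = V \<inter> L"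
    using assms unfolding C1_submanifold_def by meson
  note hom = UV(4)[unfolded homeomorphism_def]
  define x0 where "x0 = \<phi> x"
  have x0: "x0 \<in> V" "x0 \<in> L" using slice UV(2) assms(2) unfolding x0_def by blast+
  have \<psi>x0: "\<psi> x0 = x" using hom UV(2) by (simp add: x0_def)
  obtain r1 K1 where 1: "0 < r1" "0 < K1" "cball x r1 \<subseteq> U"
    "\<And>y z. y \<in> cball x r1 \<Longrightarrow> z \<in> cball x r1 \<Longrightarrow> norm (\<phi> y - \<phi> z) \<le> K1 * norm (y - z)"
    using C1_on_locally_lipschitz[OF UV(5,1,2)] by metis
  obtain r2 K2 where 2: "0 < r2" "0 < K2" "cball x0 r2 \<subseteq> V"
    "\<And>y z. y \<in> cball x0 r2 \<Longrightarrow> z \<in> cball x0 r2 \<Longrightarrow> norm (\<psi> y - \<psi> z) \<le> K2 * norm (y - z)"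
    using C1_on_locally_lipschitz[OF UV(6,3) x0(1)] by metis
  \<comment> \<open>The bound \<open>r2\<close> keeps y where \<psi> is Lipschitz; the bound
    \<open>r1 / K2\<close> keeps \<psi> y in the ball about x where \<phi> is Lipschitz.\<close>
  define r where "r = min r2 (r1 / K2)"
  define K where "K = max 1 (max K1 K2)"
  have r: "0 < r" "r \<le> r2" "K2 * r \<le> r1"
    using 1(1) 2(1,2) by (auto simp: r_def min_def field_simps)
  have K: "1 \<le> K" "K1 \<le> K" "K2 \<le> K" by (auto simp: K_def)
  have inV: "y \<in> V" "y \<in> cball x0 r2" if "y \<in> cball x0 r" for y using that r(2) 2(3) by auto
  have near: "\<psi> y \<in> cball x r1" if y: "y \<in> cball x0 r" for y
  proof -
    have "norm (\<psi> x0 - \<psi> y) \<le> K2 * norm (x0 - y)" using inV(2)[OF y] 2(1) by (intro 2(4)) auto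
    also have "\<dots> \<le> K2 * r" using y 2(2) by (intro mult_left_mono) (auto simp: dist_norm)
    finally show ?thesis using r(3) by (simp add: \<psi>x0 dist_norm)
  qed
  define T where "T = U \<inter> \<phi> -` ball x0 r"
  have "open T"
    unfolding T_def using hom UV(1) by (intro continuous_open_preimage) auto
  show thesis
  proof (rule that[OF L x0(2) r(1) K(1) _ _ \<open>open T\<close>, where g = \<psi>])
    fix y z assume yz: "y \<in> cball x0 r \<inter> L" "z \<in> cball x0 r \<inter> L"
    have "norm (\<psi> y - \<psi> z) \<le> K2 * norm (y - z)" using yz inV(2) by (intro 2(4)) auto
    also have "\<dots> \<le> K * norm (y - z)" using K by (intro mult_right_mono) auto
    finally show "norm (\<psi> y - \<psi> z) \<le> K * norm (y - z)" .
    have "\<phi> (\<psi> y) = y" "\<phi> (\<psi> z) = z" using hom inV(1) yz by auto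
    then have "norm (y - z) \<le> K1 * norm (\<psi> y - \<psi> z)"
      using 1(4)[of "\<psi> y" "\<psi> z"] near yz by auto
    also have "\<dots> \<le> K * norm (\<psi> y - \<psi> z)" using K by (intro mult_right_mono) auto
    finally show "norm (y - z) \<le> K * norm (\<psi> y - \<psi> z)" .
  next
    show "x \<in> T" using UV(2) r(1) by (simp add: T_def flip: x0_def)
    show "M \<inter> T \<subseteq> \<psi> ` (cball x0 r \<inter> L)"
    proof
      fix y assume y: "y \<in> M \<inter> T"
      then have "\<phi> y \<in> cball x0 r" "y \<in> U" by (auto simp: T_def)
      moreover have "\<phi> y \<in> L" using y slice by (auto simp: T_def)
      moreover have "y = \<psi> (\<phi> y)" using hom \<open>y \<in> U\<close> by simp
      ultimately show "y \<in> \<psi> ` (cball x0 r \<inter> L)" by blast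
    qed
    show "\<psi> ` (cball x0 r \<inter> L) \<subseteq> M"
    proof clarify
      fix y assume y: "y \<in> cball x0 r" "y \<in> L"
      then have "y \<in> \<phi> ` (U \<inter> M)" using inV(1) slice by blast
      then show "\<psi> y \<in> M" using hom by auto
    qed
  qed
qed

text \<open>Above d all of \<open>M\<close> is null, chart by chart; below d a single chart already
  meets \<open>S\<close> in a set that is not null. The empty set must be excluded, since it is a
  submanifold of every dimension but has Hausdorff dimension 0.\<close>

theorem hausdorff_dim_submanifold_Int_absolute_winning:
  fixes M S :: "'a::euclidean_space set"
  assumes "absolute_winning UNIV S" "C1_submanifold d M" "M \<noteq> {}"
  shows "hausdorff_dim (M \<inter> S) = ereal (real d)"
proof (rule hausdorff_dim_eqI)
  fix s assume s: "real d < s"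
  have "hausdorff_measure s M = 0"
  proof (rule hausdorff_measure_locally_null)
    fix x assume "x \<in> M"
    with assms(2) obtain L and g :: "'a \<Rightarrow> 'a" and x0 r K T where
      "subspace L" "dim L = d" "x0 \<in> L" "0 < r" "1 \<le> K"
      "\<And>y z. y \<in> cball x0 r \<inter> L \<Longrightarrow> z \<in> cball x0 r \<inter> L \<Longrightarrow> norm (g y - g z) \<le> K * norm (y - z)"
      and T: "open T" "x \<in> T" "M \<inter> T \<subseteq> g ` (cball x0 r \<inter> L)"
      by (rule C1_submanifold_local_parametrization) blast
    then have "hausdorff_measure s (g ` (cball x0 r \<inter> L)) = 0"
      using s by (intro hausdorff_measure_lipschitz_slice_null[where K = K]) auto
    then show "\<exists>T. open T \<and> x \<in> T \<and> hausdorff_measure s (M \<inter> T) = 0"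
      using T hausdorff_measure_null_subset by blast
  qed (use s in linarith)
  then show "hausdorff_measure s (M \<inter> S) = 0"
    by (rule hausdorff_measure_null_subset) blast
next
  fix s assume s: "0 < s" "s < real d"
  obtain x where "x \<in> M" using assms(3) by blast
  with assms(2) obtain L and g :: "'a \<Rightarrow> 'a" and x0 r K where
    L: "subspace L" "dim L = d" "x0 \<in> L" "0 < r" "1 \<le> K"
    and g: "\<And>y z. y \<in> cball x0 r \<inter> L \<Longrightarrow> z \<in> cball x0 r \<inter> L \<Longrightarrow> norm (g y - g z) \<le> K * norm (y - z)"
      "\<And>y z. y \<in> cball x0 r \<inter> L \<Longrightarrow> z \<in> cball x0 r \<inter> L \<Longrightarrow> norm (y - z) \<le> K * norm (g y - g z)"
      "g ` (cball x0 r \<inter> L) \<subseteq> M"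
    by (rule C1_submanifold_local_parametrization) blast
  have "hausdorff_measure s (g ` (cball x0 r \<inter> L) \<inter> S) \<noteq> 0"
    by (rule absolute_winning_slice_not_null[OF assms(1) L(1,3-5) g(1,2)]) (use s L(2) in auto)
  then show "hausdorff_measure s (M \<inter> S) \<noteq> 0"
    using hausdorff_measure_null_subset[of s "M \<inter> S" "g ` (cball x0 r \<inter> L) \<inter> S"] g(3) by blast
qed simp

theorem theorem1p6:
  fixes \<alpha> :: "real ^ 'n ^ 'm"
  assumes "CARD('m) \<ge> 2"
    and "badly_approximable \<alpha>"
  shows "absolute_winning UNIV (Tad \<alpha>) \<and>
    (\<forall>(M :: (real ^ 'm) set) d. C1_submanifold d M \<and> M \<noteq> {} \<longrightarrow>
       hausdorff_dim (M \<inter> Tad \<alpha>) = ereal (real d))"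
  using absolute_winning_Tad[OF assms(2)] hausdorff_dim_submanifold_Int_absolute_winning
  by blast

end
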